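(* Assume that $g_\theta$ and $g_\kappa$ both have radius of convergence $R>0$ and are holomorphic in some domain $\Delta_0$, that $g_\kappa^{\{1\}}(R)=1$ and $0<g_\kappa^{\{2\}}(R)<\infty$, and that for some $\theta^*\ge0$, $\delta>0$, as $z\to R$, $z\in\Delta_0$, $$g_\theta(z)=-\theta^*\log(1-z/R)+O((1-z/R)^\delta),\quad g_\kappa(z)=g_\kappa(R)-(1-z/R)+\tfrac12g_\kappa^{\{2\}}(R)(1-z/R)^2+O((1-z/R)^{2+\delta}).$$ Let $f:\Delta_0\to\mathbb C$ be holomorphic with $f(z)=1+O((1-z/R)^\delta)$ as $z\to R$, $z\in\Delta_0$. Then for any $u\ge0$, as $N\to\infty$, $$[z^N]\big[f(z)\exp\{e^{-u/\sqrt N}G_N(z)\}\big]\sim\frac{\exp\{Ng_\kappa(R)-\sqrt N\,u\,g_\kappa(R)+\tfrac12u^2g_\kappa(R)\}}{R^N}\big(\tfrac12Nb_2(R)\big)^{(\theta^*-1)/2}\frac{J_{\tilde u}(\theta^* )}{2\pi i},$$ where $\tilde u=u\sqrt{2/b_2(R)}$. In particular, $$H_N\sim\frac{\exp\{Ng_\kappa(R)\}\cdot\big(\tfrac12Nb_2(R)\big)^{(\theta^*-1)/2}}{2R^N\,\Gamma\big(\frac{1+\theta^*}{2}\big)},\qquad N\to\infty.$$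
   Context: $(\theta_j)_{j\ge1}$, $(\kappa_j)_{j\ge1}$ are sequences of nonnegative reals; $g_\theta(z)=\sum_{j\ge1}\theta_jz^j/j$, $g_\kappa(z)=\sum_{j\ge1}\kappa_jz^j/j$, $G_N=g_\theta+Ng_\kappa$. $[z^N]F(z)$ is the coefficient of $z^N$. $H_N=\frac1{N!}\sum_{\sigma\in S_N}\prod_{j=1}^N(\theta_j+N\kappa_j)^{C_j(\sigma)}$, $C_j(\sigma)$ the number of $j$-cycles of $\sigma$. $g^{\{n\}}(z)=z^ng^{(n)}(z)$, $g_\kappa^{\{n\}}(R):=\lim_{r\uparrow R}g_\kappa^{\{n\}}(r)$; $b_2(R)=g_\kappa^{\{1\}}(R)+g_\kappa^{\{2\}}(R)$. Domain: for $\eta>0$, $\varphi\in(0,\pi/2)$, $\Delta_0=\{z\in\mathbb C:|z|<R|1+\eta e^{i\varphi}|,\ z\ne R,\ |\arg(z-R)|>\varphi\}$. Logs and powers use principal branches. Standing assumption: $(\kappa_j)$ is non-arithmetic (no integer $j_0>1$ such that $\kappa_j\ne0$ implies $j_0\mid j$) and $\kappa_j>0$ for some $j\ge2$. The function $J_\xi(\sigma)$ ($\xi\in\mathbb R$, $\sigma\in\mathbb C$): fix $\varphi'\in(\pi/4,\pi/2)$ and $\epsilon>0$; let $\gamma'$ be the contour coming from $\infty e^{-i\varphi'}$ along the ray $\{ye^{-i\varphi'}:y\ge\epsilon\}$ to $\epsilon e^{-i\varphi'}$, then along the arc $\{\epsilon e^{-it}:t\in[\varphi',2\pi-\varphi']\}$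 (passing through $-\epsilon$) to $\epsilon e^{i\varphi'}$, then out along the ray $\{ye^{i\varphi'}:y\ge\epsilon\}$ to $\infty e^{i\varphi'}$; $J_\xi(\sigma)=\int_{\gamma'}(-w)^{-\sigma}\exp\{-\xi w+w^2\}\,dw$, with the principal branch of $(-w)^{-\sigma}$ (the integral is independent of $\varphi',\epsilon$). *)

theory Defs
  imports "HOL-Complex_Analysis.Complex_Analysis" "HOL-Library.Landau_Symbols"
begin

text \<open>g_a(z) = sum_{j>=1} a_j z^j / j  (the j = 0 term vanishes since x / 0 = 0).\<close>
definition gfun :: "(nat \<Rightarrow> real) \<Rightarrow> complex \<Rightarrow> complex" where
  "gfun a z = (\<Sum>j. complex_of_real (a j / real j) * z ^ j)"

definition gcoeffs :: "(nat \<Rightarrow> real) \<Rightarrow> nat \<Rightarrow> complex" where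
  "gcoeffs a j = complex_of_real (a j / real j)"

definition greal :: "(nat \<Rightarrow> real) \<Rightarrow> real \<Rightarrow> real" where
  "greal a r = (\<Sum>j. a j / real j * r ^ j)"

definition zcoeff :: "nat \<Rightarrow> (complex \<Rightarrow> complex) \<Rightarrow> complex" where
  "zcoeff N F = (deriv ^^ N) F 0 / of_nat (fact N)"

definition Delta0 :: "real \<Rightarrow> real \<Rightarrow> real \<Rightarrow> complex set" where
  "Delta0 R eta phi = {z. norm z < R * norm (1 + complex_of_real eta * cis phi)
       \<and> z \<noteq> complex_of_real R \<and> \<bar>Arg (z - complex_of_real R)\<bar> > phi}"

text \<open>Truncated contour gamma' with phi' = pi/3, epsilon = 1, rays cut at radius Y.\<close>
definition Jpath :: "real \<Rightarrow> real \<Rightarrow> complex" where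
  "Jpath Y = linepath (of_real Y * cis (-(pi/3))) (cis (-(pi/3)))
             +++ part_circlepath 0 1 (-(pi/3)) (pi/3 - 2*pi)
             +++ linepath (cis (pi/3)) (of_real Y * cis (pi/3))"

definition Jfun :: "real \<Rightarrow> complex \<Rightarrow> complex" where
  "Jfun xi sg = Lim at_top (\<lambda>Y::real. contour_integral (Jpath Y)
      (\<lambda>w. (- w) powr (- sg) * exp (- complex_of_real xi * w + w ^ 2)))"

definition perm_orbit :: "(nat \<Rightarrow> nat) \<Rightarrow> nat \<Rightarrow> nat set" where
  "perm_orbit s x = {(s ^^ k) x | k. True}"

definition ncycles :: "nat \<Rightarrow> (nat \<Rightarrow> nat) \<Rightarrow> nat \<Rightarrow> nat" where
  "ncycles N s j = card {perm_orbit s x | x. x \<in> {1..N} \<and> card (perm_orbit s x) = j}"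

definition HN :: "(nat \<Rightarrow> real) \<Rightarrow> (nat \<Rightarrow> real) \<Rightarrow> nat \<Rightarrow> real" where
  "HN theta kappa N = (1 / fact N) *
     (\<Sum>s\<in>{s. s permutes {1..N}}. \<Prod>j=1..N. (theta j + real N * kappa j) ^ ncycles N s j)"

end

theory Submission
  imports Defs "HOL-Combinatorics.Combinatorics" "HOL-Probability.Probability" "HOL-Real_Asymp.Real_Asymp"
begin

text \<open>
  The coefficient is a Cauchy integral over the circle \<open>\<bar>z\<bar> = R e^(-c/sqrt N)\<close>, which lies inside the
  disc of convergence: the continuation beyond the disc is not needed, only the behaviour on the
  closed disc. In the coordinate \<open>z = R e^(-v/sqrt N)\<close>, \<open>v = c - i y\<close>, the power \<open>z^(-N)\<close> is exactly
  \<open>R^(-N) e^(v sqrt N)\<close>, and because \<open>g_kappa^{1}(R) = 1\<close> the linear terms of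
  \<open>N g_kappa(z) - N log z\<close> cancel. What remains is the Gaussian \<open>e^(b v^2)\<close>, \<open>b = b_2(R)/2\<close>, multiplied
  by \<open>v^(-theta*)\<close> and \<open>e^(u v)\<close>. Away from the positive real axis non-arithmeticity gives
  \<open>Re g_kappa(z) < g_kappa(R)\<close>, hence a Gaussian majorant and dominated convergence.

  The contour of \<open>J\<close> can be moved to a vertical line as well. Writing \<open>v^(-theta*)\<close> as the Laplace
  transform of \<open>t^(theta* - 1) / Gamma(theta*)\<close> turns \<open>J\<close> into a positive Gaussian moment; therefore
  \<open>J\<close> does not vanish, and its value at \<open>u = 0\<close> follows from the duplication formula.
\<close>

section \<open>Cycle weights and the exponential formula\<close>

text \<open>Put \<open>q = v / sqrt N\<close>, so that \<open>z = R * exp (- q)\<close>, and let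
  \<open>e = exp (- u / sqrt N)\<close> be the tilt. It acts twice. From
  \<open>N * e = N - u * sqrt N + u^2 / 2 + o(1)\<close> the value of g_kappa at \<open>R\<close>
  contributes three terms to the exponent. And the linear terms cancel only up to
  \<open>N * (1 - e) * q = sqrt N * (1 - e) * v\<close>, whose limit \<open>u * v\<close> is the
  source of the second exponential. In \<open>b = (1 + c2) / 2\<close> the extra
  \<open>1 / 2\<close> stems from the coordinate:
  \<open>1 - exp (- q) = q - q^2 / 2 + o(q^2)\<close>. The power of \<open>N\<close> is composed of
  \<open>N^(theta_star / 2)\<close> from the logarithm in g_theta and \<open>N^(-1/2)\<close> from
  the Jacobian \<open>dy / sqrt N\<close>. Equivalence is obtained by dividing by the limit of the
  integral, which is why J must not vanish.

  H_N is the case \<open>f = 1\<close>, \<open>u = 0\<close>, once it is known to be a coefficient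
  of \<open>exp G_N\<close>. For that, both the normalised weighted permutation sums and the
  coefficients of the exponential are shown to obey
  \<open>n * e_n = (sum over j from 1 to n of w_j * e_(n-j))\<close>: the former by the cycle
  through a marked point, the latter by \<open>F' = G' * F\<close>.\<close>

lemma perm_orbit_subset:
  assumes "x \<in> B" "\<And>y. y \<in> B \<Longrightarrow> s y \<in> B"
  shows "perm_orbit s x \<subseteq> B"
proof -
  have "(s ^^ k) x \<in> B" for k by (induction k) (use assms in auto)
  thus ?thesis by (auto simp: perm_orbit_def)
qed

lemma perm_orbit_self [simp]: "x \<in> perm_orbit s x"
  unfolding perm_orbit_def by (auto intro: exI[of _ 0])

lemma perm_orbit_step: "y \<in> perm_orbit s x \<Longrightarrow> s y \<in> perm_orbit s x"
  unfolding perm_orbit_def by (auto intro: exI[of _ "Suc _"])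

lemma perm_orbit_trans: "y \<in> perm_orbit s x \<Longrightarrow> perm_orbit s y \<subseteq> perm_orbit s x"
  by (rule perm_orbit_subset) (auto intro: perm_orbit_step)

text \<open>Orbits are defined by forward iteration only. Since \<open>s\<close> returns to
  \<open>x\<close> after some \<open>n > 0\<close> steps, \<open>x\<close> is reached from
  \<open>y = (s ^^ k) x\<close> by \<open>n * k - k\<close> further steps, so orbits are equivalence
  classes.\<close>

lemma perm_orbit_eq:
  assumes "s permutes A" "finite A" "y \<in> perm_orbit s x"
  shows "perm_orbit s y = perm_orbit s x"
proof
  show "perm_orbit s y \<subseteq> perm_orbit s x" by (rule perm_orbit_trans) fact
  have "permutation s" using assms by (auto simp: permutation_permutes)
  then obtain n where n: "(s ^^ n) x = x" "n > 0" by (rule permutation_self)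
  obtain k where k: "y = (s ^^ k) x" using assms unfolding perm_orbit_def by blast
  have fix': "(s ^^ (n * m)) x = x" for m
    by (induction m) (simp_all add: funpow_add n)
  have "(s ^^ (n * k - k)) y = (s ^^ (n * k)) x"
    unfolding k using n(2) by (simp flip: funpow_add o_apply[of "s ^^ _"])
  hence "x \<in> perm_orbit s y" unfolding perm_orbit_def by (metis (mono_tags, lifting) fix' mem_Collect_eq)
  thus "perm_orbit s x \<subseteq> perm_orbit s y" by (rule perm_orbit_trans)
qed

lemma perm_orbit_in:
  assumes "s permutes A" "x \<in> A" shows "perm_orbit s x \<subseteq> A"
  by (rule perm_orbit_subset) (use assms in \<open>auto simp: permutes_in_image\<close>)

context
  fixes q :: "nat \<Rightarrow> nat" and S a b
  assumes q: "q permutes S" and fin: "finite S" and a: "a \<notin> S" and b: "b \<in> S"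
begin

text \<open>Composition with the transposition splices the new point \<open>a\<close> into the cycle
  of \<open>b\<close>, directly in front of \<open>b\<close>: the old predecessor of
  \<open>b\<close> is sent to \<open>a\<close>, and \<open>a\<close> to \<open>b\<close>. Everything
  else is unchanged.\<close>

lemma transpose_comp_simps:
  "(Transposition.transpose a b \<circ> q) a = b"
  "x \<in> S \<Longrightarrow> q x \<noteq> b \<Longrightarrow> (Transposition.transpose a b \<circ> q) x = q x"
  "q x = b \<Longrightarrow> (Transposition.transpose a b \<circ> q) x = a"
proof -
  show "(Transposition.transpose a b \<circ> q) a = b" using permutes_not_in[OF q a] by simp
  show "(Transposition.transpose a b \<circ> q) x = q x" if "x \<in> S" "q x \<noteq> b"
    using that a permutes_in_image[OF q, of x] by (auto simp: Transposition.transpose_def)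
  show "(Transposition.transpose a b \<circ> q) x = a" if "q x = b" using that by simp
qed

lemma perm_orbit_insert:
  "perm_orbit (Transposition.transpose a b \<circ> q) a = insert a (perm_orbit q b)" (is "perm_orbit ?p a = _")
proof
  show "perm_orbit ?p a \<subseteq> insert a (perm_orbit q b)"
  proof (rule perm_orbit_subset)
    fix y assume y: "y \<in> insert a (perm_orbit q b)"
    show "?p y \<in> insert a (perm_orbit q b)"
    proof (cases "y = a")
      case True thus ?thesis by (simp only: transpose_comp_simps(1)) auto
    next
      case False
      hence y: "y \<in> perm_orbit q b" "y \<in> S" using y perm_orbit_in[OF q b] by auto
      show ?thesis
      proof (cases "q y = b")
        case True thus ?thesis by (simp only: transpose_comp_simps(3)) auto
      next
        case False
        show ?thesis by (simp only: transpose_comp_simps(2)[OF y(2) False])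
          (use y(1) in \<open>auto intro: perm_orbit_step\<close>)
      qed
    qed
  qed auto
  have ba: "b \<in> perm_orbit ?p a"
    using perm_orbit_step[OF perm_orbit_self, of ?p a] by (simp only: transpose_comp_simps(1))
  have "perm_orbit q b \<subseteq> perm_orbit ?p a \<inter> S"
  proof (rule perm_orbit_subset)
    fix y assume y: "y \<in> perm_orbit ?p a \<inter> S"
    show "q y \<in> perm_orbit ?p a \<inter> S"
    proof (cases "q y = b")
      case True thus ?thesis using ba b by auto
    next
      case False
      have "?p y \<in> perm_orbit ?p a" by (rule perm_orbit_step) (use y in blast)
      moreover have "?p y = q y" by (rule transpose_comp_simps(2)) (use y False in auto)
      moreover have "q y \<in> S" using y permutes_in_image[OF q, of y] by blast
      ultimately show ?thesis by simp
    qed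
  qed (use ba b in auto)
  thus "insert a (perm_orbit q b) \<subseteq> perm_orbit ?p a" by auto
qed

lemma perm_orbit_insert_other:
  assumes x: "x \<in> S" "x \<notin> perm_orbit q b"
  shows "perm_orbit (Transposition.transpose a b \<circ> q) x = perm_orbit q x" (is "perm_orbit ?p x = _")
proof -
  have b': "b \<notin> perm_orbit q x" using perm_orbit_eq[OF q fin, of b x] x perm_orbit_self by blast
  have "(?p ^^ k) x = (q ^^ k) x" for k
  proof (induction k)
    case (Suc k)
    have *: "(q ^^ k) x \<in> S" "q ((q ^^ k) x) \<noteq> b"
      using perm_orbit_in[OF q x(1)] b' perm_orbit_step[of "(q ^^ k) x" q x]
      unfolding perm_orbit_def by auto
    show ?case using Suc transpose_comp_simps(2)[OF *] by simp
  qed simp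
  thus ?thesis by (simp add: perm_orbit_def)
qed

text \<open>Splicing touches a single cycle, so the product of the weights of all unmarked cycles is
  the same before and after.\<close>

lemma perm_orbit_image_insert:
  "perm_orbit (Transposition.transpose a b \<circ> q) ` insert a S - {perm_orbit (Transposition.transpose a b \<circ> q) a}
     = perm_orbit q ` S - {perm_orbit q b}" (is "?L = ?R")
proof
  let ?p = "Transposition.transpose a b \<circ> q"
  have p: "?p permutes insert a S"
    by (rule permutes_compose) (use q b in \<open>auto intro: permutes_subset permutes_swap_id\<close>)
  show "?L \<subseteq> ?R"
  proof
    fix c assume "c \<in> ?L"
    then obtain x where x: "x \<in> S" "c = perm_orbit ?p x" "c \<noteq> perm_orbit ?p a" by auto
    have n: "x \<notin> perm_orbit q b"
      using x perm_orbit_eq[OF p, of x a] fin unfolding perm_orbit_insert by auto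
    have "perm_orbit q x \<noteq> perm_orbit q b" using n perm_orbit_self by blast
    thus "c \<in> ?R" using x perm_orbit_insert_other[OF x(1) n] by auto
  qed
  show "?R \<subseteq> ?L"
  proof
    fix c assume "c \<in> ?R"
    then obtain x where x: "x \<in> S" "c = perm_orbit q x" "c \<noteq> perm_orbit q b" by auto
    have n: "x \<notin> perm_orbit q b" using perm_orbit_eq[OF q fin, of x b] x by auto
    have "perm_orbit ?p x = c" using x perm_orbit_insert_other[OF x(1) n] by auto
    moreover have "a \<notin> c" using perm_orbit_in[OF q x(1)] a x by auto
    ultimately show "c \<in> ?L" using x perm_orbit_self by blast
  qed
qed

lemma card_perm_orbit_insert:
  "card (perm_orbit (Transposition.transpose a b \<circ> q) a) = Suc (card (perm_orbit q b))"
  unfolding perm_orbit_insert using perm_orbit_in[OF q b] fin a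
  by (subst card_insert_disjoint) (auto intro: finite_subset)

end

section \<open>Weighted sums over permutations\<close>

definition cycle_weight :: "(nat \<Rightarrow> 'a::comm_ring_1) \<Rightarrow> (nat \<Rightarrow> nat) \<Rightarrow> nat set \<Rightarrow> 'a" where
  "cycle_weight w s A = (\<Prod>c\<in>perm_orbit s ` A. w (card c))"

text \<open>The cycle of the marked point carries its own weight \<open>v\<close>: deleting the marked point from its
  cycle replaces \<open>v\<close> by \<open>v \<circ> Suc\<close>, which makes the induction on the size of the set close.\<close>

definition marked_weight ::
  "(nat \<Rightarrow> 'a::comm_ring_1) \<Rightarrow> (nat \<Rightarrow> 'a) \<Rightarrow> nat \<Rightarrow> (nat \<Rightarrow> nat) \<Rightarrow> nat set \<Rightarrow> 'a" where
  "marked_weight w v x s A =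
     v (card (perm_orbit s x)) * (\<Prod>c\<in>perm_orbit s ` A - {perm_orbit s x}. w (card c))"

lemma marked_weight_same:
  "finite A \<Longrightarrow> x \<in> A \<Longrightarrow> marked_weight w w x s A = cycle_weight w s A"
  unfolding marked_weight_def cycle_weight_def
  by (rule prod.remove[symmetric]) auto

text \<open>Every permutation of \<open>insert a S\<close> is uniquely a transposition of
  \<open>a\<close> and \<open>b\<close> after a permutation \<open>q\<close> of \<open>S\<close>.
  For \<open>b = a\<close> the marked point is fixed, which gives \<open>v 1\<close>; for
  \<open>b\<close> in \<open>S\<close> it lengthens the cycle of \<open>b\<close> by one, which
  gives \<open>v \<circ> Suc\<close> with \<open>b\<close> as the new marked point.\<close>

lemma sum_marked_weight_insert:
  fixes S :: "nat set"
  assumes "finite S" "a \<notin> S"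
  shows "(\<Sum>p | p permutes insert a S. marked_weight w v a p (insert a S)) =
     v 1 * (\<Sum>q | q permutes S. cycle_weight w q S) +
     (\<Sum>b\<in>S. \<Sum>q | q permutes S. marked_weight w (v \<circ> Suc) b q S)"
proof -
  have 1: "marked_weight w v a (Transposition.transpose a a \<circ> q) (insert a S) = v 1 * cycle_weight w q S"
    if q: "q permutes S" for q
  proof -
    have "q a = a" using permutes_not_in[OF q assms(2)] .
    hence "(q ^^ k) a = a" for k by (induction k) auto
    hence o: "perm_orbit q a = {a}" by (auto simp: perm_orbit_def)
    moreover have "perm_orbit q ` insert a S - {perm_orbit q a} = perm_orbit q ` S"
    proof -
      have "perm_orbit q a \<noteq> perm_orbit q x" if "x \<in> S" for x
        using perm_orbit_in[OF q that] assms(2) perm_orbit_self by blast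
      thus ?thesis by auto
    qed
    ultimately show ?thesis unfolding marked_weight_def cycle_weight_def by simp
  qed
  have 2: "marked_weight w v a (Transposition.transpose a b \<circ> q) (insert a S) = marked_weight w (v \<circ> Suc) b q S"
    if q: "q permutes S" "b \<in> S" for q b
    unfolding marked_weight_def perm_orbit_image_insert[OF q(1) assms q(2)]
      card_perm_orbit_insert[OF q(1) assms q(2)] by simp
  show ?thesis
    unfolding sum_over_permutations_insert[OF assms] sum.insert[OF assms] sum_distrib_left
    by (intro arg_cong2[of _ _ _ _ "(+)"] sum.cong refl) (simp_all add: 1 2 del: transpose_same)
qed

text \<open>In a set of size \<open>n\<close>, exactly \<open>fact (n - 1) / fact (n - l)\<close>
  cycles of length \<open>l\<close> pass through \<open>x\<close>, and the rest contributes
  \<open>fact (n - l) * e (n - l)\<close>; this explains the second formula. The first is the second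
  at \<open>v = w\<close>, read through the recurrence. Both are carried through one induction, with
  \<open>v\<close> and the marked point arbitrary.\<close>

lemma sum_marked_weight:
  fixes w :: "nat \<Rightarrow> 'a::field_char_0"
  assumes e0: "e 0 = 1"
    and e_Suc: "\<And>n. of_nat (Suc n) * e (Suc n) = (\<Sum>j\<le>n. w (Suc j) * e (n - j))"
  assumes "finite A" "card A = n"
  shows "(\<Sum>p | p permutes A. cycle_weight w p A) = fact n * e n" 
    and "x \<in> A \<Longrightarrow> (\<Sum>p | p permutes A. marked_weight w v x p A)
           = fact (n - 1) * (\<Sum>j<n. v (Suc j) * e (n - Suc j))"
  using assms(3,4)
proof (induction n arbitrary: A v x)
  case 0
  {
    case 1
    hence "A = {}" by auto
    thus ?case using e0 by (simp add: cycle_weight_def)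
  next
    case 2
    thus ?case by auto
  }
next
  case (Suc n)
  \<comment> \<open>The second claim at size \<open>Suc n\<close>. It needs only the induction
    hypotheses at size \<open>n\<close> and then yields both claims of the step.\<close>
  have main: "(\<Sum>p | p permutes A. marked_weight w v x p A)
           = fact n * (\<Sum>j\<le>n. v (Suc j) * e (n - j))"
    if A: "finite A" "card A = Suc n" "x \<in> A" for v x A
  proof -
    define S where "S = A - {x}"
    have S: "A = insert x S" "x \<notin> S" "finite S" "card S = n" using A by (auto simp: S_def)
    have IH2: "(\<Sum>q | q permutes S. marked_weight w (v \<circ> Suc) b q S)
        = fact (n - 1) * (\<Sum>j<n. v (Suc (Suc j)) * e (n - Suc j))" if "b \<in> S" for b
      using Suc.IH(2)[OF that S(3,4), of "v \<circ> Suc"] by (simp add: o_def)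
    have "(\<Sum>p | p permutes A. marked_weight w v x p A)
       = v 1 * (fact n * e n) + of_nat n * (fact (n - 1) * (\<Sum>j<n. v (Suc (Suc j)) * e (n - Suc j)))"
      unfolding S(1) sum_marked_weight_insert[OF S(3,2)] Suc.IH(1)[OF S(3,4)]
      using S(4) by (simp add: IH2)
    \<comment> \<open>For \<open>n = 0\<close> truncated subtraction makes
      \<open>fact (n - 1)\<close> equal to \<open>1\<close>, which is harmless because the factor
      \<open>of_nat n\<close> vanishes and the sum is empty.\<close>
    also have "\<dots> = fact n * (v 1 * e n + (\<Sum>j<n. v (Suc (Suc j)) * e (n - Suc j)))"
      by (cases n) (simp_all add: algebra_simps)
    also have "v 1 * e n + (\<Sum>j<n. v (Suc (Suc j)) * e (n - Suc j)) = (\<Sum>j\<le>n. v (Suc j) * e (n - j))"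
      by (simp add: sum.atMost_shift)
    finally show ?thesis .
  qed
  {
    case 1
    then obtain x where x: "x \<in> A" by fastforce
    have "(\<Sum>p | p permutes A. cycle_weight w p A) = (\<Sum>p | p permutes A. marked_weight w w x p A)"
      using 1 x by (simp add: marked_weight_same)
    also have "\<dots> = fact n * (of_nat (Suc n) * e (Suc n))"
      unfolding e_Suc using main[OF 1 x] .
    also have "\<dots> = fact (Suc n) * e (Suc n)" by simp
    finally show ?case .
  next
    case 2
    thus ?case using main[OF 2(2,3,1)] by (simp add: lessThan_Suc_atMost)
  }
qed

text \<open>Grouping the cycles by length turns the product over cycles into powers. The lengths lie
  between \<open>1\<close> and \<open>N\<close>, so no cycle is lost.\<close>

lemma prod_ncycles:
  fixes w :: "nat \<Rightarrow> 'a::comm_ring_1"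
  assumes s: "s permutes {1..N}"
  shows "(\<Prod>j=1..N. w j ^ ncycles N s j) = cycle_weight w s {1..N}"
proof -
  have "card c \<in> {1..N}" if c: "c \<in> perm_orbit s ` {1..N}" for c
  proof -
    from c obtain x where x: "x \<in> {1..N}" "c = perm_orbit s x" by auto
    have "c \<subseteq> {1..N}" using perm_orbit_in[OF s x(1)] x by simp
    moreover have "x \<in> c" using x by simp
    ultimately show ?thesis
      using card_mono[of "{1..N}" c] by (auto simp: Suc_le_eq card_gt_0_iff intro: finite_subset)
  qed
  hence "cycle_weight w s {1..N} =
      (\<Prod>j\<in>{1..N}. \<Prod>c\<in>{c \<in> perm_orbit s ` {1..N}. card c = j}. w (card c))"
    unfolding cycle_weight_def by (intro prod.group[symmetric]) auto
  also have "\<dots> = (\<Prod>j=1..N. w j ^ ncycles N s j)"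
  proof (rule prod.cong[OF refl])
    fix j
    have "{perm_orbit s x | x. x \<in> {1..N} \<and> card (perm_orbit s x) = j} =
        {c \<in> perm_orbit s ` {1..N}. card c = j}" by auto
    thus "(\<Prod>c\<in>{c \<in> perm_orbit s ` {1..N}. card c = j}. w (card c)) = w j ^ ncycles N s j"
      unfolding ncycles_def by simp
  qed
  finally show ?thesis by simp
qed

section \<open>The exponential formula for the generating functions\<close>

lemma gfun_has_fps_expansion:
  assumes "conv_radius (gcoeffs a) > 0"
  shows "gfun a has_fps_expansion Abs_fps (gcoeffs a)"
proof -
  have "eval_fps (Abs_fps (gcoeffs a)) = gfun a"
    by (auto simp: eval_fps_def gfun_def gcoeffs_def)
  thus ?thesis using assms
    unfolding has_fps_expansion_def by (auto simp: fps_conv_radius_def)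
qed

text \<open>Read coefficientwise, this differential equation is the recurrence required by
  \<open>sum_marked_weight\<close>. It is proved for germs at \<open>0\<close> and transferred by
  uniqueness of expansions, so no composition of formal series occurs.\<close>

lemma exp_fps_recurrence:
  fixes g :: "complex \<Rightarrow> complex"
  assumes g: "g has_fps_expansion G" and F: "(\<lambda>z. exp (g z)) has_fps_expansion F"
  shows "fps_deriv F = fps_deriv G * F"
proof -
  obtain r where r: "r > 0" "g holomorphic_on ball 0 r"
    using has_fps_expansion_imp_analytic_0[OF g] unfolding analytic_on_def by auto
  have "(\<lambda>z. deriv g z * exp (g z)) has_fps_expansion fps_deriv G * F"
    by (intro has_fps_expansion_mult has_fps_expansion_deriv g F)
  moreover have "eventually (\<lambda>z. deriv (\<lambda>z. exp (g z)) z = deriv g z * exp (g z)) (nhds 0)"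
    using eventually_nhds_in_open[of "ball 0 r" "0::complex"] r(1)
  proof (simp, elim eventually_mono)
    fix z :: complex assume "cmod z < r"
    hence "(g has_field_derivative deriv g z) (at z)"
      using holomorphic_derivI[OF r(2)] by auto
    thus "deriv (\<lambda>z. exp (g z)) z = deriv g z * exp (g z)"
      by (intro DERIV_imp_deriv) (auto intro!: derivative_eq_intros)
  qed
  ultimately have "deriv (\<lambda>z. exp (g z)) has_fps_expansion fps_deriv G * F"
    by (subst has_fps_expansion_cong) auto
  moreover have "deriv (\<lambda>z. exp (g z)) has_fps_expansion fps_deriv F"
    by (intro has_fps_expansion_deriv F)
  ultimately show ?thesis by (rule fps_expansion_unique_complex[symmetric])
qed

text \<open>\<open>N\<close> occurs both as the size of the set and inside the weights. The weights
  are frozen first, which gives an ordinary exponential formula valid for all sizes, and only then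
  is the size \<open>N\<close> selected.\<close>

lemma HN_eq_zcoeff:
  assumes "conv_radius (gcoeffs theta) > 0" "conv_radius (gcoeffs kappa) > 0"
  shows "complex_of_real (HN theta kappa N) =
           zcoeff N (\<lambda>z. exp (gfun theta z + of_nat N * gfun kappa z))"
proof -
  define w where "w = (\<lambda>j. complex_of_real (theta j + real N * kappa j))"
  define g where "g = (\<lambda>z. gfun theta z + of_nat N * gfun kappa z)"
  define G where "G = Abs_fps (gcoeffs theta) + fps_const (of_nat N) * Abs_fps (gcoeffs kappa)"
  define F where "F = fps_expansion (\<lambda>z. exp (g z)) 0"
  have g: "g has_fps_expansion G"
    unfolding g_def G_def using assms
    by (intro has_fps_expansion_add has_fps_expansion_cmult_left gfun_has_fps_expansion)
  have F: "(\<lambda>z. exp (g z)) has_fps_expansion F"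
    unfolding F_def
    by (intro analytic_at_imp_has_fps_expansion_0 analytic_intros has_fps_expansion_imp_analytic_0[OF g])
  have G_nth: "of_nat (Suc n) * fps_nth G (Suc n) = w (Suc n)" for n
    using of_nat_neq_0[of n, where 'a=complex] by (simp add: G_def gcoeffs_def w_def divide_simps)
  have "of_nat (Suc n) * fps_nth F (Suc n) = (\<Sum>j\<le>n. w (Suc j) * fps_nth F (n - j))" for n
  proof -
    have "of_nat (Suc n) * fps_nth F (Suc n) = fps_nth (fps_deriv F) n" by simp
    also have "\<dots> = (\<Sum>j\<le>n. w (Suc j) * fps_nth F (n - j))"
      unfolding exp_fps_recurrence[OF g F] fps_mult_nth atLeast0AtMost fps_deriv_nth
      by (intro sum.cong refl) (simp add: G_nth del: of_nat_Suc)
    finally show ?thesis .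
  qed
  \<comment> \<open>The constant terms of both series are zero by the convention
    \<open>x / 0 = 0\<close>, so the exponential starts with \<open>1\<close>.\<close>
  moreover have "fps_nth F 0 = 1"
    using has_fps_expansion_imp_0_eq_fps_nth_0[OF F] has_fps_expansion_imp_0_eq_fps_nth_0[OF g]
    by (simp add: G_def gcoeffs_def)
  ultimately have "(\<Sum>p | p permutes {1..N}. cycle_weight w p {1..N}) = fact N * fps_nth F N"
    by (intro sum_marked_weight(1)) auto
  moreover have "complex_of_real (HN theta kappa N) =
      1 / fact N * (\<Sum>p | p permutes {1..N}. cycle_weight w p {1..N})"
    unfolding HN_def of_real_mult of_real_sum
    by (intro arg_cong2[of _ _ _ _ "(*)"] sum.cong)
       (simp_all add: w_def prod_ncycles[symmetric, unfolded One_nat_def])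
  ultimately show ?thesis by (simp add: F_def fps_expansion_def zcoeff_def g_def)
qed

section \<open>Hankel's contour integral on a vertical line\<close>

text \<open>Euler's integral after \<open>t \<mapsto> a * t\<close>, restated as a Lebesgue integral
  over the whole line so that termwise integration and Fubini apply to it.\<close>

lemma has_bochner_integral_gamma_scaled:
  fixes s a :: real
  assumes s: "s > 0" and a: "a > 0"
  shows "has_bochner_integral lborel (\<lambda>t. indicator {0<..} t * (t powr (s - 1) * exp (- (a * t)))) (Gamma s / a powr s)"
proof -
  have "((\<lambda>t. t powr (s - 1) / exp t) has_integral Gamma s) {0<..}"
  proof -
    have "((\<lambda>t. if t \<in> {0<..} then t powr (s - 1) / exp t else 0) has_integral Gamma s) {0..}"
      by (rule has_integral_spike[of "{0}", rotated 2, OF Gamma_integral_real[OF s]]) auto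
    thus ?thesis by (subst (asm) has_integral_restrict) auto
  qed
  hence "set_integrable lborel {0<..} (\<lambda>t. t powr (s - 1) / exp t)"
    and I: "(LBINT t:{0<..}. t powr (s - 1) / exp t) = Gamma s"
  proof -
    assume *: "((\<lambda>t. t powr (s - 1) / exp t) has_integral Gamma s) {0<..}"
    have "(\<lambda>t. t powr (s - 1) / exp t) absolutely_integrable_on {0<..}"
      by (rule nonnegative_absolutely_integrable_1) (use * in auto)
    thus i: "set_integrable lborel {0<..} (\<lambda>t. t powr (s - 1) / exp t)"
      unfolding set_integrable_def by (subst (asm) integrable_completion) auto
    from set_borel_integral_eq_integral(2)[OF i] *
    show "(LBINT t:{0<..}. t powr (s - 1) / exp t) = Gamma s"
      by (simp add: integral_unique)
  qed
  hence "has_bochner_integral lborel (\<lambda>t. indicator {0<..} t *\<^sub>R (t powr (s - 1) / exp t)) (Gamma s)"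
    by (simp add: has_bochner_integral_iff set_integrable_def set_lebesgue_integral_def)
  hence "has_bochner_integral lborel (\<lambda>t. indicator {0<..} (0 + a * t) *\<^sub>R ((0 + a * t) powr (s - 1) / exp (0 + a * t)))
     (Gamma s /\<^sub>R \<bar>a\<bar>)"
    using a by (subst (asm) lborel_has_bochner_integral_real_affine_iff[of a _ _ 0]) auto
  hence "has_bochner_integral lborel (\<lambda>t. a powr (1 - s) * (indicator {0<..} (0 + a * t) *\<^sub>R ((0 + a * t) powr (s - 1) / exp (0 + a * t))))
     (a powr (1 - s) * (Gamma s /\<^sub>R \<bar>a\<bar>))"
    by (rule has_bochner_integral_mult_right) 
  also have "a powr (1 - s) * (Gamma s /\<^sub>R \<bar>a\<bar>) = Gamma s / a powr s"
    using a by (simp add: powr_diff field_simps)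
  also have "(\<lambda>t. a powr (1 - s) * (indicator {0<..} (0 + a * t) *\<^sub>R ((0 + a * t) powr (s - 1) / exp (0 + a * t))))
     = (\<lambda>t. indicator {0<..} t * (t powr (s - 1) * exp (- (a * t))))"
    using a by (auto simp: fun_eq_iff indicator_def zero_less_mult_iff powr_mult powr_diff exp_minus field_simps)
  finally show ?thesis .
qed

text \<open>Both sides are \<open>Gamma s\<close> times a rising factorial over
  \<open>fact k\<close>. This turns the moments of the Gamma density into the coefficients of the
  binomial series with exponent \<open>- s\<close>.\<close>

lemma Gamma_add_nat_over_fact:
  assumes "s > (0::real)"
  shows "Gamma (s + real k) / fact k = Gamma s * ((-1) ^ k * (-s gchoose k))"
proof -
  have "s \<notin> \<int>\<^sub>\<le>\<^sub>0" using assms by (auto elim!: nonpos_Ints_cases)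
  thus ?thesis
    using pochhammer_Gamma[of s k] Gamma_real_pos[OF assms]
    by (auto simp: gbinomial_pochhammer field_simps simp flip: power_add)
qed

text \<open>The integrand is expanded in powers of \<open>v - a\<close>, where \<open>a > 0\<close> is so large
  that \<open>v\<close> lies in the disc of radius \<open>a\<close> about \<open>a\<close>; this produces the binomial series.\<close>

lemma has_bochner_integral_gamma_complex:
  fixes s :: real and v :: complex
  assumes s: "s > 0" and v: "Re v > 0"
  shows "has_bochner_integral lborel
     (\<lambda>t. indicator {0<..} t *\<^sub>R (of_real (t powr (s - 1)) * exp (- (v * of_real t))))
     (of_real (Gamma s) * v powr (- of_real s))"
proof -
  \<comment> \<open>The disc of radius \<open>a\<close> about \<open>a\<close> contains
    \<open>v\<close> as soon as \<open>2 * a * Re v\<close> exceeds the squared modulus of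
    \<open>v\<close>; this choice is twice the critical value.\<close>
  define a where "a = (cmod v)\<^sup>2 / Re v"
  define d where "d = v - of_real a"
  have v0: "v \<noteq> 0" using v by auto
  have a: "a > 0" using v v0 by (simp add: a_def)
  have "(cmod d)\<^sup>2 = (cmod v)\<^sup>2 - 2 * a * Re v + a\<^sup>2"
    unfolding d_def cmod_power2 by (simp add: power2_eq_square algebra_simps)
  also have "2 * a * Re v = 2 * (cmod v)\<^sup>2" using v by (simp add: a_def)
  finally have "(cmod d)\<^sup>2 < a\<^sup>2" using v0 by simp
  hence da: "cmod d < a" using a by (simp add: power2_less_imp_less)
  define F where "F = (\<lambda>k t. (indicator {0<..} t * (t powr (s + real k - 1) * exp (- (a * t)))))"
  define f where "f = (\<lambda>k t. ((- d) ^ k / fact k) * complex_of_real (F k t))"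
  have F: "has_bochner_integral lborel (F k) (Gamma (s + real k) / a powr (s + real k))" for k
    unfolding F_def by (rule has_bochner_integral_gamma_scaled) (use s a in auto)
  have F_nonneg: "F k t \<ge> 0" for k t by (simp add: F_def)
  have int_f: "has_bochner_integral lborel (f k) (((- d) ^ k / fact k) * of_real (Gamma (s + real k) / a powr (s + real k)))" for k
    unfolding f_def by (intro has_bochner_integral_mult_right has_bochner_integral_of_real F)
  have f_sums: "(\<lambda>k. f k t) sums (indicator {0<..} t *\<^sub>R (of_real (t powr (s - 1)) * exp (- (v * of_real t))))"
    and f_abs: "summable (\<lambda>k. norm (f k t))" for t
  proof -
    define c where "c = indicator {0<..} t * t powr (s - 1) * exp (- (a * t))"
    have pw: "(- (d * complex_of_real t)) ^ k = (- d) ^ k * of_real t ^ k" for k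
      by (metis mult_minus_left power_mult_distrib)
    have eq: "f k t = of_real c * ((- d * of_real t) ^ k /\<^sub>R fact k)" for k
      using pw[of k] by (auto simp: f_def F_def c_def indicator_def powr_add powr_diff powr_realpow scaleR_conv_of_real field_simps)
    have "(\<lambda>k. of_real c * ((- d * of_real t) ^ k /\<^sub>R fact k)) sums (of_real c * exp (- d * of_real t))"
      by (intro sums_mult exp_converges)
    also have "of_real c * exp (- d * of_real t) = indicator {0<..} t *\<^sub>R (of_real (t powr (s - 1)) * exp (- (v * of_real t)))"
      by (simp add: c_def d_def indicator_def flip: exp_of_real exp_add)
         (simp add: algebra_simps)
    finally show "(\<lambda>k. f k t) sums (indicator {0<..} t *\<^sub>R (of_real (t powr (s - 1)) * exp (- (v * of_real t))))"
      by (simp add: eq)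
    show "summable (\<lambda>k. norm (f k t))"
      unfolding eq norm_mult by (intro summable_mult summable_norm_exp)
  qed
  \<comment> \<open>The \<open>L1\<close> norms are again terms of a binomial series, now at the
    real point \<open>- (cmod d / a)\<close> inside its disc of convergence. Their summability
    justifies the exchange of sum and integral.\<close>
  have norm_f: "(LBINT t. norm (f k t)) = Gamma s / a powr s * ((-s gchoose k) * (- (cmod d / a)) ^ k)" for k
  proof -
    have "(LBINT t. norm (f k t)) = (LBINT t. (cmod d ^ k / fact k) * F k t)"
      unfolding f_def norm_mult
      by (intro Bochner_Integration.integral_cong) (auto simp: norm_divide norm_power F_nonneg)
    also have "\<dots> = (cmod d ^ k / fact k) * (Gamma (s + real k) / a powr (s + real k))"
      using has_bochner_integral_mult_right[OF F, of "cmod d ^ k / fact k" k] 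
      by (simp add: has_bochner_integral_iff)
    also have "\<dots> = cmod d ^ k * (Gamma (s + real k) / fact k) / a powr (s + real k)"
      by simp
    also have "\<dots> = Gamma s / a powr s * ((-s gchoose k) * (- (cmod d / a)) ^ k)"
      unfolding Gamma_add_nat_over_fact[OF s] using a
      by (simp add: powr_add powr_realpow power_divide power_minus[of "_ / _"] field_simps)
    finally show ?thesis .
  qed
  have sm: "summable (\<lambda>k. LBINT t. norm (f k t))"
    unfolding norm_f
    by (intro summable_mult sums_summable[OF gen_binomial_real]) (use da a in auto)
  note * = integrable_suminf[OF integrable.intros[OF int_f] AE_I2[OF f_abs] sm]
    sums_integral[OF integrable.intros[OF int_f] AE_I2[OF f_abs] sm]
  have sum_eq: "(\<lambda>t. \<Sum>k. f k t) = (\<lambda>t. indicator {0<..} t *\<^sub>R (of_real (t powr (s - 1)) * exp (- (v * of_real t))))"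
    using f_sums by (auto simp: fun_eq_iff sums_iff)
  have "integral\<^sup>L lborel (f k) = of_real (Gamma s / a powr s) * ((- of_real s gchoose k) * (d / of_real a) ^ k)" for k
  proof -
    have "integral\<^sup>L lborel (f k) = (- d) ^ k * of_real (Gamma (s + real k) / fact k) / of_real (a powr (s + real k))"
      using int_f[of k] by (simp add: has_bochner_integral_iff)
    also have "\<dots> = of_real (Gamma s / a powr s) * ((of_real (- s gchoose k)) * (d / of_real a) ^ k)"
      unfolding Gamma_add_nat_over_fact[OF s] using a
      by (simp add: powr_add powr_realpow power_divide power_minus[of d] field_simps)
    also have "complex_of_real (- s gchoose k) = (- of_real s gchoose k)"
      by (simp add: gbinomial_prod_rev)
    finally show ?thesis .
  qed
  moreover have "(\<lambda>k. of_real (Gamma s / a powr s) * ((- of_real s gchoose k) * (d / of_real a) ^ k)) sums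
     (of_real (Gamma s / a powr s) * (1 + d / of_real a) powr (- of_real s))"
    by (intro sums_mult gen_binomial_complex) (use da a in \<open>auto simp: norm_divide\<close>)
  ultimately have "(LBINT t. (\<Sum>k. f k t)) = of_real (Gamma s / a powr s) * (1 + d / of_real a) powr (- of_real s)"
    using *(2) by (simp add: sums_iff)
  also have "\<dots> = of_real (Gamma s) * v powr (- of_real s)"
  proof -
    have "v = of_real a * (1 + d / of_real a)" using a by (simp add: d_def field_simps)
    hence "v powr (- of_real s) = of_real a powr (- of_real s) * (1 + d / of_real a) powr (- of_real s)"
      using a powr_times_real_left[of "of_real a" "1 + d / of_real a" "- of_real s"] by simp
    also have "complex_of_real a powr (- of_real s) = of_real (1 / a powr s)"
      using a powr_of_real[of a "-s"] by (simp add: powr_minus divide_inverse)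
    finally show ?thesis by simp
  qed
  finally show ?thesis using *(1) unfolding sum_eq has_bochner_integral_iff by blast
qed

section \<open>Gaussian integrals and J as a positive moment\<close>

lemma has_bochner_integral_gauss_fourier:
  "has_bochner_integral lborel (\<lambda>y. exp (\<i> * of_real (a * y) - of_real (y\<^sup>2)))
     (complex_of_real (sqrt pi * exp (- (a\<^sup>2) / 4)))"
proof -
  have A: "integrable lborel (\<lambda>x. std_normal_density x *\<^sub>R iexp (a / sqrt 2 * x))"
  proof (rule Bochner_Integration.integrable_bound[OF integrable_normal_density[of 1 0]])
    show "(\<lambda>x. std_normal_density x *\<^sub>R iexp (a / sqrt 2 * x)) \<in> borel_measurable lborel" by measurable
  qed auto
  \<comment> \<open>The Fourier integral is the characteristic function of the standard normal law
    at \<open>a / sqrt 2\<close>; the substitution \<open>x = sqrt 2 * y\<close> then rescales the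
    density.\<close>
  have "char std_normal_distribution (a / sqrt 2) = (LBINT x. std_normal_density x *\<^sub>R iexp (a / sqrt 2 * x))"
    unfolding char_def by (subst integral_density) auto
  hence "(LBINT x. std_normal_density x *\<^sub>R iexp (a / sqrt 2 * x)) = of_real (exp (- (a\<^sup>2) / 4))"
    by (simp add: char_std_normal_distribution power_divide)
  with A have "has_bochner_integral lborel (\<lambda>x. std_normal_density x *\<^sub>R iexp (a / sqrt 2 * x)) (complex_of_real (exp (- (a\<^sup>2) / 4)))"
    by (simp add: has_bochner_integral_iff)
  hence "has_bochner_integral lborel (\<lambda>x. std_normal_density (0 + sqrt 2 * x) *\<^sub>R iexp (a / sqrt 2 * (0 + sqrt 2 * x)))
       (complex_of_real (exp (- (a\<^sup>2) / 4)) /\<^sub>R \<bar>sqrt 2\<bar>)"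
    by (subst (asm) lborel_has_bochner_integral_real_affine_iff[of "sqrt 2" _ _ 0]) auto
  hence "has_bochner_integral lborel (\<lambda>x. of_real (sqrt (2 * pi)) * (std_normal_density (0 + sqrt 2 * x) *\<^sub>R iexp (a / sqrt 2 * (0 + sqrt 2 * x))))
       (of_real (sqrt (2 * pi)) * (complex_of_real (exp (- (a\<^sup>2) / 4)) /\<^sub>R \<bar>sqrt 2\<bar>))"
    by (rule has_bochner_integral_mult_right)
  also have "of_real (sqrt (2 * pi)) * (complex_of_real (exp (- (a\<^sup>2) / 4)) /\<^sub>R \<bar>sqrt 2\<bar>)
      = complex_of_real (sqrt pi * exp (- (a\<^sup>2) / 4))"
    by (simp add: real_sqrt_mult scaleR_conv_of_real)
  also have "(\<lambda>x. of_real (sqrt (2 * pi)) * (std_normal_density (0 + sqrt 2 * x) *\<^sub>R iexp (a / sqrt 2 * (0 + sqrt 2 * x))))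
     = (\<lambda>y. exp (\<i> * of_real (a * y) - of_real (y\<^sup>2)))"
    by (auto simp: fun_eq_iff std_normal_density_def scaleR_conv_of_real power_mult_distrib exp_diff exp_minus field_simps
             simp flip: exp_of_real)
  finally show ?thesis .
qed

lemma integrable_gauss:
  assumes "a > 0" shows "integrable lborel (\<lambda>y::real. exp (- (a * y\<^sup>2)))"
proof -
  have "integrable lborel (\<lambda>y. norm (exp (\<i> * of_real (0 * y) - of_real (y\<^sup>2))))"
    by (intro integrable_norm) (use has_bochner_integral_gauss_fourier[of 0] in \<open>auto simp: has_bochner_integral_iff\<close>)
  hence "integrable lborel (\<lambda>y::real. exp (- (y\<^sup>2)))" by (simp add: norm_exp_eq_Re)
  hence "integrable lborel (\<lambda>y::real. exp (- ((0 + sqrt a * y)\<^sup>2)))"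
    by (rule lborel_integrable_real_affine) (use assms in auto)
  thus ?thesis using assms by (simp add: power_mult_distrib)
qed

text \<open>The integrand of J on the line \<open>w = -1 + \<i> * y\<close>, written in
  \<open>- w = 1 - \<i> * y\<close>, which has positive real part and so stays off the branch cut.
  The factor \<open>\<i>\<close> from \<open>dw = \<i> * dy\<close> is left out.\<close>

definition Jline :: "real \<Rightarrow> real \<Rightarrow> complex" where
  "Jline xi s = (LBINT y. (1 - \<i> * of_real y) powr (- of_real s) *
      exp (of_real xi * (1 - \<i> * of_real y) + (1 - \<i> * of_real y)\<^sup>2))"

text \<open>The exponent expands to \<open>x + 1 - \<i> * (x + 2) * y - y^2\<close>, a Fourier
  integral at frequency \<open>- x - 2\<close>, and the constants combine because
  \<open>x + 1 - (x + 2)^2 / 4 = - x^2 / 4\<close>.\<close>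

lemma has_bochner_integral_gauss_line:
  "has_bochner_integral lborel
     (\<lambda>y. exp (of_real x * (1 - \<i> * of_real y) + (1 - \<i> * of_real y)\<^sup>2))
     (complex_of_real (sqrt pi * exp (- (x\<^sup>2) / 4)))"
proof -
  have "has_bochner_integral lborel
     (\<lambda>y. of_real (exp (x + 1)) * exp (\<i> * of_real ((- x - 2) * y) - of_real (y\<^sup>2)))
     (of_real (exp (x + 1)) * complex_of_real (sqrt pi * exp (- ((- x - 2)\<^sup>2) / 4)))"
    by (intro has_bochner_integral_mult_right has_bochner_integral_gauss_fourier)
  also have "of_real (exp (x + 1)) * complex_of_real (sqrt pi * exp (- ((- x - 2)\<^sup>2) / 4)) =
     complex_of_real (sqrt pi * exp (- (x\<^sup>2) / 4))"
  proof -
    have "exp (x + 1) * exp (- ((- x - 2)\<^sup>2) / 4) = exp (- (x\<^sup>2) / 4)"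
      by (simp add: power2_eq_square field_simps flip: exp_add)
    thus ?thesis by (metis (no_types, lifting) mult.left_commute of_real_mult)
  qed
  also have "(\<lambda>y. of_real (exp (x + 1)) * exp (\<i> * of_real ((- x - 2) * y) - of_real (y\<^sup>2))) =
     (\<lambda>y. exp (of_real x * (1 - \<i> * of_real y) + (1 - \<i> * of_real y)\<^sup>2))"
    by (simp add: fun_eq_iff power2_eq_square algebra_simps flip: exp_of_real exp_add)
  finally show ?thesis .
qed

lemma Jline_0: "Jline xi 0 = of_real (sqrt pi * exp (- (xi\<^sup>2) / 4))"
proof -
  have "1 - \<i> * of_real y \<noteq> 0" for y by (simp add: complex_eq_iff)
  thus ?thesis using has_bochner_integral_gauss_line[of xi]
    by (simp add: Jline_def has_bochner_integral_iff)
qed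

text \<open>The Laplace factor \<open>exp (- (v * t))\<close> merely shifts \<open>xi\<close> to
  \<open>xi - t\<close> in the Gaussian, so after Fubini the inner integral over \<open>y\<close> is
  explicit. This is the origin of \<open>exp (- (xi - t)^2 / 4)\<close>.\<close>

lemma Jline_Gamma:
  fixes s xi :: real
  assumes s: "s > 0"
  defines "m \<equiv> \<lambda>t. indicator {0<..} t * (t powr (s - 1) * exp (- ((xi - t)\<^sup>2) / 4))"
  shows "integrable lborel m" "of_real (Gamma s) * Jline xi s = of_real (sqrt pi * integral\<^sup>L lborel m)"
proof -
  define v where "v = (\<lambda>y::real. 1 - \<i> * of_real y)"
  define f where "f = (\<lambda>t y. indicator {0<..} t *\<^sub>R (of_real (t powr (s - 1)) * exp (- (v y * of_real t)))
      * exp (of_real xi * v y + (v y)\<^sup>2))"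
  have meas: "case_prod f \<in> borel_measurable (lborel \<Otimes>\<^sub>M lborel)"
    unfolding f_def v_def by measurable
  have Re_v: "Re (v y) = 1" "Re ((v y)\<^sup>2) = 1 - y\<^sup>2" for y by (simp_all add: v_def power2_eq_square)
  \<comment> \<open>On the line \<open>Re v = 1\<close> the modulus factors into a Gamma density in
    \<open>t\<close> and a Gaussian in \<open>y\<close>, which gives absolute integrability on the
    product.\<close>
  have norm_f: "norm (f t y) = indicator {0<..} t * (t powr (s - 1) * exp (- (1 * t))) * (exp (xi + 1) * exp (- (1 * y\<^sup>2)))" for t y
    by (simp add: f_def norm_mult norm_exp_eq_Re Re_v indicator_def flip: exp_add)
  have fy: "has_bochner_integral lborel (\<lambda>y. f t y) (of_real (sqrt pi * m t))" for t
  proof -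
    have "has_bochner_integral lborel
     (\<lambda>y. of_real (indicator {0<..} t * t powr (s - 1)) * exp (of_real (xi - t) * (1 - \<i> * of_real y) + (1 - \<i> * of_real y)\<^sup>2))
     (of_real (indicator {0<..} t * t powr (s - 1)) * complex_of_real (sqrt pi * exp (- ((xi - t)\<^sup>2) / 4)))"
      by (intro has_bochner_integral_mult_right has_bochner_integral_gauss_line)
    also have "(\<lambda>y. of_real (indicator {0<..} t * t powr (s - 1)) * exp (of_real (xi - t) * (1 - \<i> * of_real y) + (1 - \<i> * of_real y)\<^sup>2)) = f t"
      by (simp add: f_def v_def fun_eq_iff scaleR_conv_of_real algebra_simps flip: exp_add)
    finally show ?thesis by (simp add: m_def mult_ac)
  qed
  have int: "integrable (lborel \<Otimes>\<^sub>M lborel) (case_prod f)"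
  proof (rule lborel_pair.Fubini_integrable[OF meas])
    show "integrable lborel (\<lambda>t. LBINT y. norm (case_prod f (t, y)))"
      unfolding prod.case norm_f integral_mult_right_zero
      by (intro integrable_mult_left integrable.intros[OF has_bochner_integral_gamma_scaled] s) auto
    show "AE t in lborel. integrable lborel (\<lambda>y. case_prod f (t, y))"
      using fy by (auto simp: has_bochner_integral_iff)
  qed
  have m_eq: "m t = (1 / sqrt pi) * Re (LBINT y. f t y)" for t
    using fy[of t] by (simp add: has_bochner_integral_iff)
  show "integrable lborel m"
    unfolding m_eq using lborel_pair.integrable_fst'[OF int] by (intro integrable_mult_right integrable_Re) auto
  have "of_real (Gamma s) * Jline xi s = (LBINT y. LBINT t. f t y)"
  proof -
    have "(LBINT t. f t y) = of_real (Gamma s) * v y powr (- of_real s) * exp (of_real xi * v y + (v y)\<^sup>2)" for y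
    proof -
      have "has_bochner_integral lborel (\<lambda>t. f t y) (of_real (Gamma s) * v y powr (- of_real s) * exp (of_real xi * v y + (v y)\<^sup>2))"
        unfolding f_def by (intro has_bochner_integral_mult_left has_bochner_integral_gamma_complex s) (simp add: Re_v)
      thus ?thesis by (simp add: has_bochner_integral_iff)
    qed
    thus ?thesis unfolding Jline_def by (simp add: v_def mult.assoc)
  qed
  also have "\<dots> = (LBINT t. LBINT y. f t y)"
    by (rule lborel_pair.Fubini_integral[OF int])
  also have "\<dots> = of_real (sqrt pi * integral\<^sup>L lborel m)"
  proof -
    have "(LBINT y. f t y) = of_real (sqrt pi * m t)" for t using fy[of t] by (simp add: has_bochner_integral_iff)
    thus ?thesis by simp
  qed
  finally show "of_real (Gamma s) * Jline xi s = of_real (sqrt pi * integral\<^sup>L lborel m)" .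
qed

lemma Jline_nonzero:
  assumes "s \<ge> 0" shows "Jline xi s \<noteq> 0"
proof (cases "s = 0")
  case True
  thus ?thesis by (simp add: Jline_0)
next
  case False
  hence s: "s > 0" using assms by simp
  define m where "m = (\<lambda>t. indicator {0<..} t * (t powr (s - 1) * exp (- ((xi - t)\<^sup>2) / 4)))"
  have "integral\<^sup>L lborel m \<noteq> 0"
  proof
    assume "integral\<^sup>L lborel m = 0"
    moreover have "integrable lborel m" unfolding m_def by (rule Jline_Gamma[OF s])
    ultimately have "AE t in lborel. m t = 0"
      by (subst (asm) integral_nonneg_eq_0_iff_AE) (auto simp: m_def)
    \<comment> \<open>\<open>m\<close> is strictly positive on \<open>(0, 1]\<close>, a set of
      measure one, so it cannot vanish almost everywhere.\<close>
    hence "AE t in lborel. t \<notin> {0<..1::real}"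
      by eventually_elim (auto simp: m_def indicator_def split: if_splits)
    hence "emeasure lborel {t. \<not> t \<notin> {0<..1::real}} = 0"
      by (subst (asm) AE_iff_measurable[OF _ refl]) auto
    moreover have "{t. \<not> t \<notin> {0<..1::real}} = {0<..1}" by blast
    ultimately show False by (metis emeasure_lborel_Ioc diff_zero ennreal_1 zero_le_one zero_neq_one)
  qed
  thus ?thesis using Jline_Gamma(2)[OF s, of xi] unfolding m_def by auto
qed

text \<open>The substitution \<open>x = t^2 / 4\<close> evaluates the moment at
  \<open>xi = 0\<close> as \<open>2 powr (s - 1) * Gamma (s / 2)\<close>. Duplication then cancels
  \<open>Gamma s\<close> and \<open>Gamma (s / 2)\<close>, leaving only
  \<open>Gamma ((1 + s) / 2)\<close>. For \<open>s = 0\<close> there is no Laplace representation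
  and the Gaussian value is used.\<close>

lemma Jline_xi_0:
  assumes s: "s \<ge> 0"
  shows "Jline 0 s = of_real (pi / Gamma ((1 + s) / 2))"
proof (cases "s = 0")
  case True
  have "sqrt pi = pi / sqrt pi" by (simp add: real_div_sqrt)
  thus ?thesis using True by (simp add: Jline_0 Gamma_one_half_real)
next
  case False
  hence s: "s > 0" using assms by simp
  define m where "m = (\<lambda>t. indicator {0<..} t * (t powr (s - 1) * exp (- (t\<^sup>2) / 4)))"
  define h where "h = (\<lambda>x::real. x powr (s / 2 - 1) * exp (- x))"
  have m: "integrable lborel m" "of_real (Gamma s) * Jline 0 s = of_real (sqrt pi * integral\<^sup>L lborel m)"
    using Jline_Gamma[OF s, of 0] by (simp_all add: m_def)
  have hm: "h (t\<^sup>2 / 4) * (t / 2) = 2 powr (1 - s) * (t powr (s - 1) * exp (- (t\<^sup>2) / 4))" if "t > 0" for t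
  proof -
    have "(t\<^sup>2 / 4) powr (s / 2 - 1) = ((t / 2) powr 2) powr (s / 2 - 1)"
      using that by (simp add: power_divide)
    also have "\<dots> = (t / 2) powr (s - 2)" by (simp add: powr_powr algebra_simps)
    finally show ?thesis using that
      by (simp add: h_def powr_divide powr_diff powr_minus power2_eq_square field_simps)
  qed
  have einf: "einterval 0 \<infinity> = {0<..}" by (auto simp: einterval_def zero_ereal_def)
  have int: "set_integrable lborel (einterval 0 \<infinity>) (\<lambda>t. h (t\<^sup>2 / 4) * (t / 2))"
  proof -
    have "integrable lborel (\<lambda>t. 2 powr (1 - s) * m t)" using m(1) by simp
    also have "(\<lambda>t. 2 powr (1 - s) * m t) = (\<lambda>t. indicator {0<..} t *\<^sub>R (h (t\<^sup>2 / 4) * (t / 2)))"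
      by (auto simp: fun_eq_iff m_def indicator_def hm simp del: times_divide_eq_right)
    finally show ?thesis by (simp add: set_integrable_def einf)
  qed
  have "(LBINT x=0..\<infinity>. h x) = (LBINT t=0..\<infinity>. h (t\<^sup>2 / 4) * (t / 2))"
  proof (rule interval_integral_substitution_nonneg(2)[where f = h and g = "\<lambda>t. t\<^sup>2 / 4" and g' = "\<lambda>t. t / 2", OF _ _ _ _ _ _ _ _ int])
    show "((ereal \<circ> (\<lambda>t. t\<^sup>2 / 4) \<circ> real_of_ereal) \<longlongrightarrow> 0) (at_right 0)"
      unfolding zero_ereal_def ereal_tendsto_simps
      by (auto simp: o_def zero_ereal_def intro!: tendsto_eq_intros)
    show "((ereal \<circ> (\<lambda>t. t\<^sup>2 / 4) \<circ> real_of_ereal) \<longlongrightarrow> \<infinity>) (at_left \<infinity>)"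
      unfolding ereal_tendsto_simps tendsto_PInfty_eq_at_top by real_asymp
  qed (auto simp: h_def zero_ereal_def intro!: derivative_eq_intros continuous_intros)
  hence "(LBINT x:{0<..}. h x) = (LBINT t:{0<..}. h (t\<^sup>2 / 4) * (t / 2))"
    by (simp add: interval_lebesgue_integral_def einf)
  also have "(LBINT x:{0<..}. h x) = Gamma (s / 2)"
    using has_bochner_integral_gamma_scaled[of "s / 2" 1] s
    by (simp add: has_bochner_integral_iff h_def set_lebesgue_integral_def)
  also have "(LBINT t:{0<..}. h (t\<^sup>2 / 4) * (t / 2)) = (LBINT t. 2 powr (1 - s) * m t)"
    unfolding set_lebesgue_integral_def
    by (intro Bochner_Integration.integral_cong) (auto simp: m_def indicator_def hm simp del: times_divide_eq_right)
  also have "\<dots> = 2 powr (1 - s) * integral\<^sup>L lborel m" by simp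
  finally have I: "Gamma (s / 2) = 2 powr (1 - s) * integral\<^sup>L lborel m" .
  have nn: "complex_of_real (s / 2) \<notin> \<int>\<^sub>\<le>\<^sub>0" "complex_of_real (s / 2) + 1 / 2 \<notin> \<int>\<^sub>\<le>\<^sub>0"
    using s by (auto elim!: nonpos_Ints_cases simp: complex_eq_iff)
  have "complex_of_real (Gamma (s / 2) * Gamma ((1 + s) / 2)) = of_real (2 powr (1 - s) * sqrt pi * Gamma s)"
    using Gamma_legendre_duplication[OF nn] 
    by (simp add: Gamma_complex_of_real[symmetric] powr_def add_divide_distrib exp_of_real[symmetric] algebra_simps)
  hence dup: "Gamma (s / 2) * Gamma ((1 + s) / 2) = 2 powr (1 - s) * sqrt pi * Gamma s"
    unfolding of_real_eq_iff .
  have pos: "Gamma s > 0" "Gamma ((1 + s) / 2) > 0" using s by (auto intro!: Gamma_real_pos)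
  have "integral\<^sup>L lborel m * Gamma ((1 + s) / 2) = sqrt pi * Gamma s"
    using dup unfolding I by simp
  hence "sqrt pi * integral\<^sup>L lborel m = Gamma s * (pi / Gamma ((1 + s) / 2))"
    using pos by (simp add: field_simps flip: power2_eq_square)
  hence "of_real (Gamma s) * Jline 0 s = of_real (Gamma s) * complex_of_real (pi / Gamma ((1 + s) / 2))"
    unfolding m(2) by (metis of_real_mult)
  thus ?thesis using pos by (subst (asm) mult_left_cancel) auto
qed

section \<open>Moving the contour of J to a vertical line\<close>

definition Jint :: "real \<Rightarrow> real \<Rightarrow> complex \<Rightarrow> complex" where
  "Jint xi s w = (- w) powr (- of_real s) * exp (- of_real xi * w + w\<^sup>2)"

lemma norm_powr_minus_le_1:
  assumes "s \<ge> 0" "norm w \<ge> 1"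
  shows "norm (w powr (- complex_of_real s)) \<le> 1"
proof -
  have "norm (w powr (- complex_of_real s)) = exp (- s * ln (norm w))"
    using assms by (auto simp: powr_def norm_exp_eq_Re)
  also have "\<dots> \<le> 1" using assms by (auto intro!: mult_nonneg_nonneg)
  finally show ?thesis .
qed

text \<open>For real \<open>s \<ge> 0\<close> the power has modulus at most \<open>1\<close> outside
  the unit disc, so the size is governed by the real part of \<open>w^2\<close>: the integrand is
  tiny wherever the imaginary part dominates the real part.\<close>

lemma norm_Jint_le:
  assumes "s \<ge> 0" "norm w \<ge> 1"
  shows "norm (Jint xi s w) \<le> exp (- xi * Re w + (Re w)\<^sup>2 - (Im w)\<^sup>2)"
proof -
  have "norm (Jint xi s w) = norm ((- w) powr (- of_real s)) * exp (- xi * Re w + (Re w)\<^sup>2 - (Im w)\<^sup>2)"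
    by (simp add: Jint_def norm_mult norm_exp_eq_Re power2_eq_square)
  also have "\<dots> \<le> 1 * exp (- xi * Re w + (Re w)\<^sup>2 - (Im w)\<^sup>2)"
    using norm_powr_minus_le_1[of s "- w"] assms by (intro mult_right_mono) auto
  finally show ?thesis by simp
qed

text \<open>The cut of the integrand is the nonnegative real axis. The two segments lie in open
  half-planes, and the arc runs through angles between \<open>-5 * pi / 3\<close> and
  \<open>- pi / 3\<close>, which contain no multiple of \<open>2 * pi\<close>.\<close>

lemma Jpath_props:
  assumes "Y \<ge> 2"
  shows "valid_path (Jpath Y)" "pathstart (Jpath Y) = of_real Y * cis (-(pi/3))"
    "pathfinish (Jpath Y) = of_real Y * cis (pi/3)"
    "path_image (Jpath Y) \<subseteq> - (complex_of_real ` {0..})"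
proof -
  have p: "cis (pi / 3 - 2 * pi) = cis (pi / 3)"
    by (metis cis_2pi cis_divide div_by_1)
  have e: "pathstart (part_circlepath 0 1 a b) = cis a" "pathfinish (part_circlepath 0 1 a b) = cis b" for a b
    by (simp_all add: cis_conv_exp)
  show "valid_path (Jpath Y)"
    unfolding Jpath_def
    by (intro valid_path_join valid_path_linepath valid_path_part_circlepath)
       (simp_all only: e p pathstart_join pathstart_linepath pathfinish_linepath)
  show "pathstart (Jpath Y) = of_real Y * cis (-(pi/3))"
    "pathfinish (Jpath Y) = of_real Y * cis (pi/3)" by (simp_all add: Jpath_def)
  have *: "0 \<notin> Im ` closed_segment a b" if "Im a < 0 \<and> Im b < 0 \<or> Im a > 0 \<and> Im b > 0" for a b
  proof -
    have "closed_segment a b \<subseteq> {w. Im w < 0}" if "Im a < 0" "Im b < 0"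
      by (rule closed_segment_subset) (use that in \<open>auto simp: convex_halfspace_Im_lt\<close>)
    moreover have "closed_segment a b \<subseteq> {w. Im w > 0}" if "Im a > 0" "Im b > 0"
      by (rule closed_segment_subset) (use that in \<open>auto simp: convex_halfspace_Im_gt\<close>)
    ultimately have "closed_segment a b \<subseteq> {w. Im w < 0} \<or> closed_segment a b \<subseteq> {w. Im w > 0}"
      using that by blast
    thus ?thesis by auto
  qed
  have s3: "sin (pi / 3) > 0" by (simp add: sin_60)
  have A: "closed_segment (of_real Y * cis (-(pi/3))) (cis (-(pi/3))) \<subseteq> - (complex_of_real ` {0..})"
    using *[of "of_real Y * cis (-(pi/3))" "cis (-(pi/3))"] assms s3 by (auto simp: image_iff)
  have B: "closed_segment (cis (pi/3)) (of_real Y * cis (pi/3)) \<subseteq> - (complex_of_real ` {0..})"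
    using *[of "cis (pi/3)" "of_real Y * cis (pi/3)"] assms s3 by (auto simp: image_iff)
  have C: "path_image (part_circlepath 0 1 (-(pi/3)) (pi/3 - 2*pi)) \<subseteq> - (complex_of_real ` {0..})"
  proof
    fix w assume "w \<in> path_image (part_circlepath 0 1 (-(pi/3)) (pi/3 - 2*pi))"
    then obtain t where t: "w = cis t" "t \<in> closed_segment (-(pi/3)) (pi/3 - 2*pi)"
      by (auto simp: path_image_part_circlepath' )
    hence "- (5 * pi / 3) \<le> t" "t \<le> - (pi / 3)"
      by (auto simp: closed_segment_eq_real_ivl split: if_splits)
    hence t': "- (2 * pi) < t" "t < 0" using pi_gt_zero by linarith+
    have False if x: "cis t = of_real x" "x \<ge> 0" for x
    proof -
      have "x = 1" using arg_cong[OF x(1), of norm] x(2) by simp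
      hence "cos t = 1" using arg_cong[OF x(1), of Re] by simp
      then obtain n :: int where n: "t = of_int n * 2 * pi" by (auto simp: cos_one_2pi_int)
      hence "(-1) * (2 * pi) < of_int n * (2 * pi)" "of_int n * (2 * pi) < 0 * (2 * pi)" using t' by simp_all
      hence "of_int n < (0::real)" "of_int n > (-1::real)" by (simp_all only: mult_less_cancel_right_pos pi_gt_zero mult_pos_pos zero_less_numeral)
      moreover from this(1) have "n \<le> -1" by simp
      hence "real_of_int n \<le> real_of_int (-1)" by (simp only: of_int_le_iff)
      ultimately show False by simp
    qed
    thus "w \<in> - (complex_of_real ` {0..})" using t by auto
  qed
  show "path_image (Jpath Y) \<subseteq> - (complex_of_real ` {0..})"
    unfolding Jpath_def using A B C
    by (intro subset_trans[OF path_image_join_subset] Un_least) auto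
qed

lemma integrable_Jint_line:
  assumes "s \<ge> 0"
  shows "integrable lborel (\<lambda>y. Jint xi s (-1 + \<i> * of_real y))"
proof (rule Bochner_Integration.integrable_bound)
  show "integrable lborel (\<lambda>y::real. exp (xi + 1) * exp (- (1 * y\<^sup>2)))"
    by (intro integrable_mult_right integrable_gauss) auto
  have "continuous_on UNIV (\<lambda>y. Jint xi s (-1 + \<i> * of_real y))"
    unfolding Jint_def by (intro continuous_intros) (auto simp: complex_nonpos_Reals_iff)
  thus "(\<lambda>y. Jint xi s (-1 + \<i> * of_real y)) \<in> borel_measurable lborel"
    by (simp add: borel_measurable_continuous_onI)
  have "norm (Jint xi s (-1 + \<i> * of_real y)) \<le> exp (xi + 1) * exp (- (1 * y\<^sup>2))" for y
    using norm_Jint_le[OF assms, of "-1 + \<i> * of_real y" xi] abs_Re_le_cmod[of "-1 + \<i> * of_real y"]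
    by (simp flip: exp_add)
  thus "AE y in lborel. norm (Jint xi s (-1 + \<i> * of_real y)) \<le> norm (exp (xi + 1) * exp (- (1 * y\<^sup>2)))"
    by simp
qed

text \<open>The slit plane is starlike, so the integrand has a primitive \<open>G\<close> there and
  every contour integral is a difference of two values of \<open>G\<close>. It remains to compare
  \<open>G\<close> at the ends \<open>P\<close>, \<open>Q\<close> of the two rays with
  \<open>G\<close> at the points of the line \<open>Re w = -1\<close> of equal height.\<close>

lemma Jfun_eq_Jline:
  assumes s: "s \<ge> 0"
  shows "Jfun xi (of_real s) = \<i> * Jline xi s"
proof -
  define S where "S = - (complex_of_real ` {0..})"
  have "closed (complex_of_real ` {0..})"
    by (intro closed_injective_linear_image) (auto simp: inj_on_def linear_of_real)
  hence S: "open S" by (auto simp: S_def)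
  have hol: "Jint xi s holomorphic_on S"
    unfolding Jint_def
    by (intro holomorphic_intros) (auto simp: S_def complex_nonpos_Reals_iff image_iff complex_eq_iff)
  obtain G where G: "\<And>w. w \<in> S \<Longrightarrow> (G has_field_derivative Jint xi s w) (at w)"
  proof -
    have "\<exists>G. \<forall>w\<in>S. (G has_field_derivative Jint xi s w) (at w)"
      by (rule holomorphic_starlike_primitive[where k = "{}"])
         (use S hol in \<open>auto simp: S_def holomorphic_on_imp_continuous_on starlike_slotted_complex_plane_right
            holomorphic_on_imp_differentiable_at\<close>)
    thus ?thesis using that by blast
  qed
  have prim: "(Jint xi s has_contour_integral (G (pathfinish g) - G (pathstart g))) g"
    if "valid_path g" "path_image g \<subseteq> S" for g
    by (rule contour_integral_primitive[OF _ that]) (auto intro: G has_field_derivative_at_within)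
  define P where "P = (\<lambda>Y. complex_of_real Y * cis (pi/3))"
  define Q where "Q = (\<lambda>Y. complex_of_real Y * cis (-(pi/3)))"
  define h where "h = (\<lambda>Y. Y * sqrt 3 / 2)"
  define v where "v = (\<lambda>y. -1 + \<i> * complex_of_real y)"
  have PQ: "Re (P Y) = Y / 2" "Im (P Y) = h Y" "Re (Q Y) = Y / 2" "Im (Q Y) = - h Y" 
           "Re (v y) = -1" "Im (v y) = y" for Y y
    by (simp_all add: P_def Q_def h_def v_def cos_60 sin_60)
  have SI: "w \<in> S" if "Im w \<noteq> 0" for w using that by (auto simp: S_def)
  have J: "contour_integral (Jpath Y) (Jint xi s) = G (P Y) - G (Q Y)" if "Y \<ge> 2" for Y
    using prim[of "Jpath Y"] Jpath_props[OF that]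
    by (simp add: S_def P_def Q_def contour_integral_unique)
  \<comment> \<open>The rays have angle \<open>pi / 3\<close>, so at radius \<open>Y\<close> the
    real part is \<open>Y / 2\<close> and the height is \<open>sqrt 3 / 2 * Y\<close>. Along the
    horizontal segment the exponent is at most \<open>\<bar>xi\<bar> * Y - Y^2 / 2\<close>.\<close>
  have horiz: "norm (G b - G a) \<le> exp (\<bar>xi\<bar> * Y + Y\<^sup>2 / 4 - (h Y)\<^sup>2) * Y"
    if Y: "Y \<ge> 2" and ab: "Re a = -1" "Re b = Y / 2" "Im a = Im b" "\<bar>Im b\<bar> = h Y" for a b Y
  proof -
    have h: "h Y \<ge> 1" using Y mult_mono[of 2 Y 1 "sqrt 3"] by (simp add: h_def)
    have seg: "Im w = Im b" "Re w \<in> {-1..Y/2}" if "w \<in> closed_segment a b" for w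
      using that ab Y closed_segment_same_Im[of a b] by (auto simp: closed_segment_eq_real_ivl)
    have "norm (G b - G a) \<le> exp (\<bar>xi\<bar> * Y + Y\<^sup>2 / 4 - (h Y)\<^sup>2) * norm (b - a)"
    proof (rule has_contour_integral_bound_linepath)
      show "(Jint xi s has_contour_integral G b - G a) (linepath a b)"
      proof -
        have "closed_segment a b \<subseteq> S"
        proof
          fix w assume "w \<in> closed_segment a b"
          hence "\<bar>Im w\<bar> \<ge> 1" using seg(1)[of w] h ab(4) by simp
          thus "w \<in> S" by (intro SI) auto
        qed
        thus ?thesis using prim[of "linepath a b"] by simp
      qed
      fix w assume w: "w \<in> closed_segment a b"
      have "norm (Jint xi s w) \<le> exp (- xi * Re w + (Re w)\<^sup>2 - (Im w)\<^sup>2)"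
        by (rule norm_Jint_le[OF s]) (use seg[OF w] ab h abs_Im_le_cmod[of w] in linarith)
      also have "\<dots> \<le> exp (\<bar>xi\<bar> * Y + Y\<^sup>2 / 4 - (h Y)\<^sup>2)"
      proof -
        have r: "\<bar>Re w\<bar> \<le> Y / 2" using seg[OF w] Y by auto
        have "- xi * Re w \<le> \<bar>xi\<bar> * \<bar>Re w\<bar>" by (metis abs_ge_self abs_minus_cancel abs_mult)
        also have "\<dots> \<le> \<bar>xi\<bar> * Y" using r Y by (intro mult_left_mono) auto
        finally have "- xi * Re w \<le> \<bar>xi\<bar> * Y" .
        moreover have "(Re w)\<^sup>2 \<le> (Y / 2)\<^sup>2" using r by (metis abs_ge_zero power2_abs power_mono)
        moreover have "(Im w)\<^sup>2 = (h Y)\<^sup>2" using seg[OF w] ab by (metis power2_abs)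
        ultimately show ?thesis by (simp add: power_divide)
      qed
      finally show "norm (Jint xi s w) \<le> exp (\<bar>xi\<bar> * Y + Y\<^sup>2 / 4 - (h Y)\<^sup>2)" .
    qed auto
    also have "norm (b - a) = Y / 2 + 1"
    proof -
      have "b - a = of_real (Y / 2 + 1)" using ab by (simp add: complex_eq_iff)
      thus ?thesis using Y by (simp only: norm_of_real)
    qed
    \<comment> \<open>The length \<open>Y / 2 + 1\<close> is at most \<open>Y\<close> exactly when
      \<open>Y \<ge> 2\<close>.\<close>
    also have "exp (\<bar>xi\<bar> * Y + Y\<^sup>2 / 4 - (h Y)\<^sup>2) * (Y / 2 + 1) \<le> exp (\<bar>xi\<bar> * Y + Y\<^sup>2 / 4 - (h Y)\<^sup>2) * Y"
      using Y by (intro mult_left_mono) auto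
    finally show ?thesis .
  qed
  have bound0: "((\<lambda>Y. exp (\<bar>xi\<bar> * Y + Y\<^sup>2 / 4 - (h Y)\<^sup>2) * Y) \<longlongrightarrow> 0) at_top"
  proof -
    have "(h Y)\<^sup>2 = 3 / 4 * Y\<^sup>2" for Y by (simp add: h_def power_divide power_mult_distrib)
    moreover have "((\<lambda>Y. exp (\<bar>xi\<bar> * Y + Y\<^sup>2 / 4 - 3 / 4 * Y\<^sup>2) * Y) \<longlongrightarrow> 0) at_top"
      by real_asymp
    ultimately show ?thesis by (simp only:)
  qed
  have T1: "((\<lambda>Y. G (P Y) - G (v (h Y))) \<longlongrightarrow> 0) at_top"
    by (rule Lim_null_comparison[OF _ bound0])
       (use eventually_ge_at_top[of 2] in \<open>eventually_elim, intro horiz, auto simp: PQ h_def\<close>)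
  have T2: "((\<lambda>Y. G (Q Y) - G (v (- h Y))) \<longlongrightarrow> 0) at_top"
    by (rule Lim_null_comparison[OF _ bound0])
       (use eventually_ge_at_top[of 2] in \<open>eventually_elim, intro horiz, auto simp: PQ h_def\<close>)
  have vert: "G (v r) - G (v (-r)) = \<i> * (LBINT y. indicator {-r..r} y *\<^sub>R Jint xi s (v y))" if "r \<ge> 0" for r
  proof -
    have "((\<lambda>y. \<i> * Jint xi s (v y)) has_integral (G (v r) - G (v (-r)))) {-r..r}"
    proof (rule fundamental_theorem_of_calculus)
      fix y assume "y \<in> {-r..r}"
      have "v y \<in> S" by (auto simp: S_def v_def complex_eq_iff)
      have vd: "(v has_vector_derivative \<i>) (at y within {-r..r})"
        unfolding v_def by (auto intro!: derivative_eq_intros has_vector_derivative_real_field)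
      show "((\<lambda>y. G (v y)) has_vector_derivative \<i> * Jint xi s (v y)) (at y within {-r..r})"
        using field_vector_diff_chain_within[OF vd has_field_derivative_at_within[OF G[OF \<open>v y \<in> S\<close>]]]
        by (simp add: o_def)
    qed (use that in auto)
    moreover have si: "set_integrable lborel {-r..r} (\<lambda>y. Jint xi s (v y))"
      unfolding set_integrable_def
      by (rule integrable_mult_indicator) (use integrable_Jint_line[OF s, of xi] in \<open>auto simp: v_def\<close>)
    hence "((\<lambda>y. \<i> * Jint xi s (v y)) has_integral (\<i> * (LBINT y:{-r..r}. Jint xi s (v y)))) {-r..r}"
      using set_borel_integral_eq_integral[OF si]
      by (intro has_integral_mult_right) (simp add: has_integral_integrable_integral)
    ultimately show ?thesis
      unfolding set_lebesgue_integral_def by (rule has_integral_unique)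
  qed
  have lim: "((\<lambda>r. LBINT y. indicator {-r..r} y *\<^sub>R Jint xi s (v y)) \<longlongrightarrow> (LBINT y. Jint xi s (v y))) at_top"
  proof (rule integral_dominated_convergence_at_top)
    show "integrable lborel (\<lambda>y. norm (Jint xi s (v y)))"
      using integrable_Jint_line[OF s, of xi] by (auto simp: v_def)
    show "AE y in lborel. ((\<lambda>r. indicator {-r..r} y *\<^sub>R Jint xi s (v y)) \<longlongrightarrow> Jint xi s (v y)) at_top"
    proof (intro AE_I2 tendsto_eventually)
      fix y :: real
      show "eventually (\<lambda>r. indicator {-r..r} y *\<^sub>R Jint xi s (v y) = Jint xi s (v y)) at_top"
        using eventually_ge_at_top[of "\<bar>y\<bar>"] by eventually_elim (auto simp: indicator_def)
    qed
    show "\<forall>\<^sub>F r in at_top. AE y in lborel. norm (indicator {-r..r} y *\<^sub>R Jint xi s (v y)) \<le> norm (Jint xi s (v y))"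
      by (auto simp: indicator_def)
  qed (use integrable_Jint_line[OF s, of xi] in \<open>auto simp: v_def dest: borel_measurable_integrable\<close>)
  have Jline_v: "Jline xi s = (LBINT y. Jint xi s (v y))"
  proof -
    have v: "v y = - (1 - \<i> * of_real y)" for y by (simp add: v_def)
    show ?thesis unfolding Jline_def Jint_def v
      by (simp only: minus_minus minus_mult_minus power2_minus)
  qed
  have "filterlim h at_top at_top" unfolding h_def by real_asymp
  from tendsto_mult[OF tendsto_const filterlim_compose[OF lim this], of \<i>]
  have "((\<lambda>Y. \<i> * (LBINT y. indicator {-h Y..h Y} y *\<^sub>R Jint xi s (v y))) \<longlongrightarrow> \<i> * Jline xi s) at_top"
    by (simp add: Jline_v)
  also have "?this \<longleftrightarrow> ((\<lambda>Y. G (v (h Y)) - G (v (- h Y))) \<longlongrightarrow> \<i> * Jline xi s) at_top"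
    by (rule tendsto_cong) (use eventually_ge_at_top[of 0] in \<open>eventually_elim, simp add: vert h_def\<close>)
  \<comment> \<open>The path from \<open>Q\<close> to \<open>P\<close> telescopes through the two
    points on the vertical line: the horizontal pieces vanish in the limit, the vertical one becomes
    the full line integral.\<close>
  finally have "((\<lambda>Y. (G (P Y) - G (v (h Y))) + (G (v (h Y)) - G (v (- h Y))) - (G (Q Y) - G (v (- h Y))))
      \<longlongrightarrow> 0 + \<i> * Jline xi s - 0) at_top"
    by (intro tendsto_diff tendsto_add T1 T2)
  hence "((\<lambda>Y. G (P Y) - G (Q Y)) \<longlongrightarrow> \<i> * Jline xi s) at_top" by simp
  also have "?this \<longleftrightarrow> ((\<lambda>Y. contour_integral (Jpath Y) (Jint xi s)) \<longlongrightarrow> \<i> * Jline xi s) at_top"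
    by (rule tendsto_cong) (use eventually_ge_at_top[of 2] in \<open>eventually_elim, simp add: J\<close>)
  finally show ?thesis unfolding Jfun_def Jint_def by (intro tendsto_Lim) auto
qed

section \<open>Laplace's method on a circle inside the disc of convergence\<close>

text \<open>The limit of the left side is \<open>u\<close>; domination needs the inequality for
  every \<open>N\<close>.\<close>

lemma sqrt_mult_one_minus_exp:
  assumes "u \<ge> 0" "N > 0"
  shows "sqrt N * (1 - exp (- u / sqrt N)) \<le> u"
proof -
  have "1 - exp (- u / sqrt N) \<le> u / sqrt N" using exp_ge_add_one_self[of "- u / sqrt N"] by simp
  hence "sqrt N * (1 - exp (- u / sqrt N)) \<le> sqrt N * (u / sqrt N)"
    using assms by (intro mult_left_mono) auto
  thus ?thesis using assms by simp
qed

text \<open>\<open>R * exp (- q)\<close> maps this set onto the closed disc without \<open>0\<close>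
  and \<open>R\<close>. The edge \<open>Re q = 0\<close> is included because the lines of
  integration \<open>Re q = c / sqrt N\<close> approach it; \<open>q = 0\<close> is the
  singularity.\<close>

definition slit_strip :: "complex set" where
  "slit_strip = {q. Re q \<ge> 0 \<and> \<bar>Im q\<bar> \<le> pi \<and> q \<noteq> 0}"

text \<open>With \<open>z = R exp (- q)\<close>, the functions \<open>A\<close>, \<open>B\<close>, \<open>C\<close> stand for \<open>f\<close>, \<open>g\<close>-theta and
  \<open>g\<close>-kappa minus its value at \<open>R\<close>.\<close>

locale saddle =
  fixes A B C :: "complex \<Rightarrow> complex" and b \<theta> u :: real
  assumes cont: "continuous_on slit_strip A" "continuous_on slit_strip B" "continuous_on slit_strip C"
    and lim_A: "(A \<longlongrightarrow> 1) (at 0 within {q. Re q > 0})"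
    and lim_B: "((\<lambda>q. B q + of_real \<theta> * Ln q) \<longlongrightarrow> 0) (at 0 within {q. Re q > 0})"
    and lim_C: "((\<lambda>q. (C q + q - of_real b * q\<^sup>2) / q\<^sup>2) \<longlongrightarrow> 0) (at 0 within {q. Re q > 0})"
    and Re_C_neg: "\<And>q. q \<in> slit_strip \<Longrightarrow> Re (C q) < 0"
    and b: "b > 0" and \<theta>: "\<theta> \<ge> 0" and u: "u \<ge> 0"
begin

definition e :: "nat \<Rightarrow> real" where "e N = exp (- u / sqrt (real N))"
text \<open>Here the free abscissa is fixed as \<open>1 / sqrt b\<close>, so that
  \<open>v (y / sqrt b) = (1 - \<i> * y) / sqrt b\<close> and the limit integral lands on the line
  used in \<open>Jline\<close>.\<close>

definition v :: "real \<Rightarrow> complex" where "v y = of_real (1 / sqrt b) - \<i> * of_real y"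
definition q :: "nat \<Rightarrow> real \<Rightarrow> complex" where "q N y = v y / of_real (sqrt (real N))"
text \<open>The Cauchy integrand with its constant exponential in the value of g_kappa at
  \<open>R\<close> divided out; the last summand of the exponent is \<open>N * q\<close>, the
  contribution of \<open>z^(-N)\<close>.\<close>

definition W :: "nat \<Rightarrow> real \<Rightarrow> complex" where
  "W N y = A (q N y) * exp (of_real (e N) * B (q N y) + of_real (e N * real N) * C (q N y) + v y * of_real (sqrt (real N)))"

lemma v_nz [simp]: "v y \<noteq> 0" using b by (auto simp: v_def complex_eq_iff)

lemma Re_v: "Re (v y) = 1 / sqrt b" and Im_v: "Im (v y) = - y" by (simp_all add: v_def)

lemma e_bounds: "e N > 0" "e N \<le> 1" by (auto simp: e_def u)

text \<open>The tilt multiplies a logarithm of size \<open>ln N\<close> coming from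
  \<open>B\<close>, so its distance from \<open>1\<close> must beat \<open>ln N\<close>; this is the
  second limit. The third produces the term \<open>u * v\<close>.\<close>

lemma e_limits:
  "e \<longlonglongrightarrow> 1" "(\<lambda>N. (e N - 1) * ln (real N)) \<longlonglongrightarrow> 0" "(\<lambda>N. sqrt (real N) * (1 - e N)) \<longlonglongrightarrow> u"
proof -
  show "e \<longlonglongrightarrow> 1" unfolding e_def by real_asymp
  show "(\<lambda>N. (e N - 1) * ln (real N)) \<longlonglongrightarrow> 0"
    unfolding e_def using u by (cases "u = 0") (simp, simp, real_asymp)
  show "(\<lambda>N. sqrt (real N) * (1 - e N)) \<longlonglongrightarrow> u"
    unfolding e_def using u by (cases "u = 0") (simp, simp, real_asymp simp: field_simps)
qed

lemma q_sq: "N > 0 \<Longrightarrow> real N * Re (q N y) = sqrt (real N) / sqrt b"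
     "N > 0 \<Longrightarrow> real N * Re ((q N y)\<^sup>2) = 1 / b - y\<^sup>2"
     "N > 0 \<Longrightarrow> real N * (cmod (q N y))\<^sup>2 = 1 / b + y\<^sup>2"
proof -
  assume N: "N > 0"
  have v2: "(v y)\<^sup>2 = of_real (1 / b - y\<^sup>2) - 2 * \<i> * of_real (y / sqrt b)"
    using b by (simp add: v_def power2_eq_square complex_eq_iff)
  have "of_real (real N) * q N y = of_real (sqrt (real N)) * v y"
    using N by (simp add: q_def field_simps flip: of_real_mult)
  hence "Re (of_real (real N) * q N y) = Re (of_real (sqrt (real N)) * v y)" by simp
  thus "real N * Re (q N y) = sqrt (real N) / sqrt b" by (simp add: Re_v)
  have "of_real (real N) * (q N y)\<^sup>2 = (v y)\<^sup>2"
    using N by (simp add: q_def power_divide flip: of_real_power)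
  hence "Re (of_real (real N) * (q N y)\<^sup>2) = Re ((v y)\<^sup>2)" by simp
  thus "real N * Re ((q N y)\<^sup>2) = 1 / b - y\<^sup>2" by (simp add: v2)
  have "(cmod (v y))\<^sup>2 = 1 / b + y\<^sup>2" using b
    by (simp add: cmod_power2 Re_v Im_v power_divide)
  thus "real N * (cmod (q N y))\<^sup>2 = 1 / b + y\<^sup>2"
    using N by (simp add: q_def norm_divide power_divide)
qed

lemma Re_q: "Re (q N y) = 1 / sqrt b / sqrt (real N)" and Im_q: "Im (q N y) = - y / sqrt (real N)"
  unfolding q_def Re_divide_of_real Im_divide_of_real Re_v Im_v by (rule refl)+

lemma Re_q_pos: "N > 0 \<Longrightarrow> Re (q N y) > 0"
  using b by (simp add: Re_q)

lemma q_in_strip: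
  assumes "N > 0" "\<bar>y\<bar> \<le> pi * sqrt (real N)"
  shows "q N y \<in> slit_strip"
proof -
  have "\<bar>Im (q N y)\<bar> \<le> pi" using assms by (simp add: Im_q abs_divide pos_divide_le_eq)
  thus ?thesis using Re_q_pos[OF assms(1), of y] by (auto simp: slit_strip_def)
qed

text \<open>\<open>B\<close> behaves like \<open>- \<theta> * Ln q\<close> with
  \<open>Ln q = Ln v - ln N / 2\<close>, so the prefactor removes the growth
  \<open>N powr (\<theta> / 2)\<close>. In \<open>e * N * C + sqrt N * v\<close> the quadratic term
  is \<open>b * v^2\<close> and the linear one is \<open>sqrt N * (1 - e) * v\<close>.\<close>

lemma W_tendsto:
  "(\<lambda>N. of_real (real N powr (- \<theta> / 2)) * W N y) \<longlonglongrightarrow>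
      v y powr (- of_real \<theta>) * exp (of_real b * (v y)\<^sup>2 + of_real u * v y)"
proof -
  have q0: "(\<lambda>N. q N y) \<longlonglongrightarrow> 0"
    unfolding q_def by (rule tendsto_norm_zero_cancel) (simp add: norm_divide, real_asymp)
  have qlim: "filterlim (\<lambda>N. q N y) (at 0 within {q. Re q > 0}) sequentially"
    unfolding filterlim_at
  proof (intro conjI q0)
    show "eventually (\<lambda>N. q N y \<in> {q. Re q > 0} \<and> q N y \<noteq> 0) sequentially"
      using eventually_gt_at_top[of 0]
    proof eventually_elim
      case (elim N)
      thus ?case using Re_q_pos[of N y] by auto
    qed
  qed
  have A: "(\<lambda>N. A (q N y)) \<longlonglongrightarrow> 1" by (rule filterlim_compose[OF lim_A qlim])
  have B: "(\<lambda>N. B (q N y) + of_real \<theta> * Ln (q N y)) \<longlonglongrightarrow> 0"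
    by (rule filterlim_compose[OF lim_B qlim])
  define E where "E = (\<lambda>N. (C (q N y) + q N y - of_real b * (q N y)\<^sup>2) / (q N y)\<^sup>2)"
  have C: "E \<longlonglongrightarrow> 0" unfolding E_def by (rule filterlim_compose[OF lim_C qlim])
  \<comment> \<open>The full exponent minus \<open>\<theta> / 2 * ln N\<close>, arranged so that
    every group has a limit of its own.\<close>
  define X where "X = (\<lambda>N. of_real (e N) * (B (q N y) + of_real \<theta> * Ln (q N y)) - of_real (e N) * of_real \<theta> * Ln (v y)
      + of_real (\<theta> / 2 * ((e N - 1) * ln (real N)))
      + (of_real (e N) * (v y)\<^sup>2 * E N + of_real (e N) * of_real b * (v y)\<^sup>2
      + v y * of_real (sqrt (real N) * (1 - e N))))"
  have "X \<longlonglongrightarrow> of_real 1 * 0 - of_real 1 * of_real \<theta> * Ln (v y) + of_real (\<theta> / 2 * 0)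
      + (of_real 1 * (v y)\<^sup>2 * 0 + of_real 1 * of_real b * (v y)\<^sup>2 + v y * of_real u)"
    unfolding X_def by (intro tendsto_intros e_limits B C)
  hence "(\<lambda>N. A (q N y) * exp (X N)) \<longlonglongrightarrow> 1 * exp (- of_real \<theta> * Ln (v y) + (of_real b * (v y)\<^sup>2 + of_real u * v y))"
    by (intro tendsto_intros A) (simp add: algebra_simps)
  hence "(\<lambda>N. A (q N y) * exp (X N)) \<longlonglongrightarrow>
      v y powr (- of_real \<theta>) * exp (of_real b * (v y)\<^sup>2 + of_real u * v y)"
    by (simp add: powr_def exp_add exp_diff exp_minus field_simps)
  moreover have "eventually (\<lambda>N. of_real (real N powr (- \<theta> / 2)) * W N y = A (q N y) * exp (X N)) sequentially"
    using eventually_gt_at_top[of 0]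
  proof eventually_elim
    case (elim N)
    define s where "s = sqrt (real N)"
    have s: "s > 0" "real N = s\<^sup>2" using elim by (simp_all add: s_def)
    have qv: "q N y = v y / of_real s" by (simp add: q_def s_def)
    have Ln: "Ln (q N y) = Ln (v y) - of_real (ln (real N) / 2)"
      unfolding qv using s by (simp add: Ln_divide_of_real ln_realpow power2_eq_square ln_mult)
    have q0: "q N y \<noteq> 0" using s by (simp add: qv)
    have "C (q N y) = - q N y + of_real b * (q N y)\<^sup>2 + (q N y)\<^sup>2 * E N"
      unfolding E_def using q0 by simp
    hence "of_real (real N) * C (q N y) = - (of_real s * v y) + of_real b * (v y)\<^sup>2 + (v y)\<^sup>2 * E N"
      unfolding qv s(2) using s(1) by (simp add: field_simps power2_eq_square)
    hence "of_real (e N * real N) * C (q N y) = of_real (e N) * (- (of_real s * v y) + of_real b * (v y)\<^sup>2 + (v y)\<^sup>2 * E N)"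
      by (simp add: mult.assoc)
    hence "of_real (e N) * B (q N y) + of_real (e N * real N) * C (q N y) + v y * of_real (sqrt (real N))
       = X N + of_real (\<theta> / 2 * ln (real N))"
      unfolding X_def Ln s_def[symmetric] by (simp add: algebra_simps)
    moreover have pw: "complex_of_real (real N powr (\<theta> / 2)) = exp (of_real (\<theta> / 2 * ln (real N)))"
      using elim by (simp only: powr_def exp_of_real) simp
    ultimately have "W N y = A (q N y) * (exp (X N) * of_real (real N powr (\<theta> / 2)))"
      unfolding W_def pw by (simp only: exp_add)
    thus ?case using elim by (simp add: powr_minus field_simps)
  qed
  ultimately show ?thesis by (rule Lim_transform_eventually[OF _ eventually_mono]) auto
qed

text \<open>Two regimes meet at \<open>cmod q = \<rho>\<close>. Near the singularity the local
  expansions hold with a relative error small enough to keep a Gaussian. Further out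
  \<open>Re C\<close> is bounded away from zero, and the gain \<open>exp (- const * N)\<close> is a
  Gaussian in \<open>y\<close> because \<open>y^2 \<le> pi^2 * N\<close>.\<close>

lemma W_dominated:
  obtains K a N0 where "a > 0"
    "\<And>N y. N \<ge> N0 \<Longrightarrow> \<bar>y\<bar> \<le> pi * sqrt (real N) \<Longrightarrow>
       norm (of_real (real N powr (- \<theta> / 2)) * W N y) \<le> K * exp (- (a * y\<^sup>2))"
proof -
  have "eventually (\<lambda>q. dist (A q) 1 < 1 \<and> dist (B q + of_real \<theta> * Ln q) 0 < 1 \<and>
      dist ((C q + q - of_real b * q\<^sup>2) / q\<^sup>2) 0 < b / 4) (at 0 within {q. Re q > 0})"
    using tendstoD[OF lim_A, of 1] tendstoD[OF lim_B, of 1] tendstoD[OF lim_C, of "b / 4"] b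
    by (intro eventually_conj) auto
  then obtain \<rho>0 where r0: "\<rho>0 > 0" "\<forall>q\<in>{q. Re q > 0}. q \<noteq> 0 \<and> dist q 0 < \<rho>0 \<longrightarrow> dist (A q) 1 < 1 \<and>
      dist (B q + of_real \<theta> * Ln q) 0 < 1 \<and> dist ((C q + q - of_real b * q\<^sup>2) / q\<^sup>2) 0 < b / 4"
    unfolding eventually_at by blast
  have \<rho>0: "dist (A q) 1 < 1" "dist (B q + of_real \<theta> * Ln q) 0 < 1"
     "dist ((C q + q - of_real b * q\<^sup>2) / q\<^sup>2) 0 < b / 4" if "Re q > 0" "cmod q < \<rho>0" for q
  proof -
    have "q \<noteq> 0" using that by auto
    thus "dist (A q) 1 < 1" "dist (B q + of_real \<theta> * Ln q) 0 < 1"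
      "dist ((C q + q - of_real b * q\<^sup>2) / q\<^sup>2) 0 < b / 4"
      using r0(2)[rule_format, of q] that by simp_all
  qed
  define \<rho> where "\<rho> = min \<rho>0 1"
  have \<rho>: "\<rho> > 0" "\<rho> \<le> 1" "\<rho> \<le> \<rho>0" using r0(1) by (auto simp: \<rho>_def)
  have near_A: "norm (A q) \<le> 2" if "Re q > 0" "cmod q < \<rho>" for q
    using \<rho>0(1)[of q] that \<rho> norm_triangle_sub[of "A q" 1] by (simp add: dist_norm)
  have near_B: "Re (B q) \<le> 1 - \<theta> * ln (cmod q)" if "Re q > 0" "cmod q < \<rho>" for q
  proof -
    have "Re (B q + of_real \<theta> * Ln q) \<le> 1" 
      using \<rho>0(2)[of q] that \<rho> complex_Re_le_cmod[of "B q + of_real \<theta> * Ln q"] by simp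
    moreover have "q \<noteq> 0" using that by auto
    ultimately show ?thesis by simp
  qed
  have near_C: "Re (C q) \<le> - Re q + b * Re (q\<^sup>2) + b / 4 * (cmod q)\<^sup>2" if "Re q > 0" "cmod q < \<rho>" for q
  proof -
    have "q \<noteq> 0" using that by auto
    hence "norm (C q + q - of_real b * q\<^sup>2) \<le> b / 4 * (cmod q)\<^sup>2"
      using \<rho>0(3)[of q] that \<rho> by (simp add: norm_divide norm_power field_simps)
    hence "Re (C q + q - of_real b * q\<^sup>2) \<le> b / 4 * (cmod q)\<^sup>2"
      using complex_Re_le_cmod[of "C q + q - of_real b * q\<^sup>2"] by linarith
    thus ?thesis by simp
  qed
  \<comment> \<open>The part of the strip away from \<open>q = 0\<close>, closed up to the imaginary
    axis. By compactness a single negative bound for \<open>Re C\<close> serves all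
    \<open>N\<close>, although the lines of integration drift towards that axis.\<close>
  define Q where "Q = cbox 0 (Complex 1 pi) \<union> cbox (Complex 0 (-pi)) (Complex 1 0) - ball 0 \<rho>"
  have Q_iff: "q \<in> Q \<longleftrightarrow> 0 \<le> Re q \<and> Re q \<le> 1 \<and> \<bar>Im q\<bar> \<le> pi \<and> cmod q \<ge> \<rho>" for q
    by (auto simp: Q_def in_cbox_complex_iff)
  have Q: "compact Q" unfolding Q_def by (intro compact_diff compact_Un compact_cbox open_ball)
  have QD: "Q \<subseteq> slit_strip" using \<rho> by (auto simp: Q_iff slit_strip_def)
  obtain K1 where K1: "K1 \<ge> 0" "\<And>q. q \<in> Q \<Longrightarrow> norm (A q) \<le> K1" "\<And>q. q \<in> Q \<Longrightarrow> norm (B q) \<le> K1"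
  proof -
    have "bounded (A ` Q)" "bounded (B ` Q)"
      using cont[THEN continuous_on_subset, OF QD] Q
      by (auto intro!: compact_imp_bounded compact_continuous_image)
    then obtain k1 k2 where "\<And>q. q \<in> Q \<Longrightarrow> norm (A q) \<le> k1" "\<And>q. q \<in> Q \<Longrightarrow> norm (B q) \<le> k2"
      unfolding bounded_iff by blast
    thus ?thesis by (intro that[of "\<bar>k1\<bar> + \<bar>k2\<bar>"]) force+
  qed
  obtain \<epsilon> where \<epsilon>: "\<epsilon> > 0" "\<And>q. q \<in> Q \<Longrightarrow> Re (C q) \<le> - \<epsilon>"
  proof -
    have ne: "Q \<noteq> {}" using \<rho> by (auto intro!: exI[of _ 1] simp: Q_iff ex_in_conv[symmetric])
    have "continuous_on Q (\<lambda>q. Re (C q))"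
      using cont(3)[THEN continuous_on_subset, OF QD] by (intro continuous_intros)
    then obtain q0 where "q0 \<in> Q" "\<And>q. q \<in> Q \<Longrightarrow> Re (C q) \<le> Re (C q0)"
      using continuous_attains_sup[OF Q ne] by blast
    thus ?thesis using Re_C_neg[of q0] QD by (intro that[of "- Re (C q0)"]) auto
  qed
  obtain N1 where N1: "\<And>N. N \<ge> N1 \<Longrightarrow> e N \<ge> 1 / 2"
    using order_tendstoD(1)[OF e_limits(1), of "1/2"] unfolding eventually_sequentially
    by (auto intro: less_imp_le)
  \<comment> \<open>\<open>N \<ge> 1 / b\<close> puts the abscissa \<open>1 / sqrt (b * N)\<close>
    inside the width \<open>1\<close> of \<open>Q\<close>.\<close>
  obtain N2 :: nat where N2: "real N2 \<ge> 1 / b" using real_arch_simple by blast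
  define N0 where "N0 = max (max N1 N2) 1"
  \<comment> \<open>Near: an error of \<open>b / 4\<close> leaves \<open>3 * b / 4\<close>, halved
    by \<open>e N \<ge> 1 / 2\<close>. Far: of the gain \<open>\<epsilon> * N / 2\<close>, one half
    absorbs the linear term and the other half must dominate \<open>a * y^2\<close> for
    \<open>y^2 \<le> pi^2 * N\<close>.\<close>
  define a where "a = min (3 * b / 8) (\<epsilon> / (4 * pi\<^sup>2))"
  define Ka where "Ka = 2 * exp (1 + \<theta> / 2 * ln b + u / sqrt b + 5 / 4)"
  define Kb where "Kb = K1 * exp (K1 + 1 / (b * \<epsilon>))"
  have a: "a > 0" using b \<epsilon> by (simp add: a_def)
  show ?thesis
  proof (rule that[of a N0 "Ka + Kb"])
    show "a > 0" by fact
    fix N y assume N: "N \<ge> N0" and y: "\<bar>y\<bar> \<le> pi * sqrt (real N)"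
    have N': "N > 0" "e N \<ge> 1 / 2" "real N \<ge> 1 / b"
      using N N1[of N] N2 by (auto simp: N0_def)
    have NW: "norm (of_real (real N powr (- \<theta> / 2)) * W N y) =
        norm (A (q N y)) * exp (- \<theta> / 2 * ln (real N) + (e N * Re (B (q N y)) + e N * real N * Re (C (q N y)) + sqrt (real N) / sqrt b))"
      using N' by (simp add: W_def norm_mult norm_exp_eq_Re Re_v powr_def flip: exp_add)
    have Rq: "Re (q N y) > 0" by (rule Re_q_pos) (use N' in auto)
    show "norm (of_real (real N powr (- \<theta> / 2)) * W N y) \<le> (Ka + Kb) * exp (- (a * y\<^sup>2))"
    proof (cases "cmod (q N y) < \<rho>")
      case True
      \<comment> \<open>The distance of \<open>q\<close> from \<open>0\<close> is at least its
        abscissa \<open>1 / sqrt (b * N)\<close>. The singular factor is therefore at most of order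
        \<open>N powr (\<theta> / 2)\<close>, which the normalisation cancels.\<close>
      have lnq: "ln (cmod (q N y)) \<le> 0" "ln (cmod (q N y)) \<ge> - ln b / 2 - ln (real N) / 2"
      proof -
        have "q N y \<noteq> 0" using Rq by auto
        thus "ln (cmod (q N y)) \<le> 0" using True \<rho> by simp
        have "1 / sqrt b / sqrt (real N) = Re (q N y)" by (simp add: Re_q)
        also have "\<dots> \<le> cmod (q N y)" by (rule complex_Re_le_cmod)
        finally have "ln (1 / sqrt b / sqrt (real N)) \<le> ln (cmod (q N y))"
          using b N' \<open>q N y \<noteq> 0\<close> by (subst ln_le_cancel_iff) (auto simp del: divide_divide_eq_left)
        thus "ln (cmod (q N y)) \<ge> - ln b / 2 - ln (real N) / 2"
          using b N' by (simp add: ln_div ln_sqrt ln_mult)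
      qed
      have "e N * Re (B (q N y)) \<le> e N * (1 - \<theta> * ln (cmod (q N y)))"
        using near_B[OF Rq True] e_bounds[of N] by (intro mult_left_mono) auto
      also have "\<dots> \<le> 1 * (1 - \<theta> * ln (cmod (q N y)))"
        using e_bounds[of N] lnq(1) \<theta> by (intro mult_right_mono) (auto simp: mult_nonneg_nonpos intro: order_trans[of _ 0])
      also have "\<dots> \<le> 1 - \<theta> * (- ln b / 2 - ln (real N) / 2)"
        using mult_left_mono[OF lnq(2) \<theta>] by simp
      finally have 1: "e N * Re (B (q N y)) \<le> 1 + \<theta> / 2 * ln b + \<theta> / 2 * ln (real N)"
        by (simp add: algebra_simps)
      have "e N * real N * Re (C (q N y)) \<le> e N * real N * (- Re (q N y) + b * Re ((q N y)\<^sup>2) + b / 4 * (cmod (q N y))\<^sup>2)"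
        using near_C[OF Rq True] e_bounds[of N] by (intro mult_left_mono) auto
      also have "\<dots> = e N * (- (real N * Re (q N y)) + b * (real N * Re ((q N y)\<^sup>2)) + b / 4 * (real N * (cmod (q N y))\<^sup>2))"
        by (simp add: algebra_simps)
      \<comment> \<open>The abscissa contributes
        \<open>b * (1 / b) + b / 4 * (1 / b) = 5 / 4\<close>, and \<open>y^2\<close> gets
        \<open>- b + b / 4\<close>.\<close>
      also have "\<dots> = e N * (- (sqrt (real N) / sqrt b) + 5 / 4 - 3 / 4 * b * y\<^sup>2)"
        unfolding q_sq[OF N'(1)] using b by (simp add: field_simps)
      also have "\<dots> = - (e N * (sqrt (real N) / sqrt b)) + e N * (5 / 4) - e N * (3 / 4 * b * y\<^sup>2)"
        by (simp add: algebra_simps)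
      finally have 2: "e N * real N * Re (C (q N y)) \<le> - (e N * (sqrt (real N) / sqrt b)) + e N * (5 / 4) - e N * (3 / 4 * b * y\<^sup>2)" .
      have 3: "e N * (5 / 4) \<le> 5 / 4" "1 / 2 * (3 / 4 * b * y\<^sup>2) \<le> e N * (3 / 4 * b * y\<^sup>2)"
        using e_bounds[of N] by simp (use N' b in \<open>intro mult_right_mono, auto\<close>)
      have 4: "sqrt (real N) / sqrt b - e N * (sqrt (real N) / sqrt b) \<le> u / sqrt b"
      proof -
        have "sqrt (real N) / sqrt b - e N * (sqrt (real N) / sqrt b) = sqrt (real N) * (1 - e N) / sqrt b"
          by (simp add: algebra_simps diff_divide_distrib)
        also have "\<dots> \<le> u / sqrt b"
          unfolding e_def using sqrt_mult_one_minus_exp[OF u, of "real N"] N' b by (intro divide_right_mono) auto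
        finally show ?thesis .
      qed
      have 5: "a * y\<^sup>2 \<le> 3 * b / 8 * y\<^sup>2" by (intro mult_right_mono) (auto simp: a_def)
      have ex: "- \<theta> / 2 * ln (real N) + (e N * Re (B (q N y)) + e N * real N * Re (C (q N y)) + sqrt (real N) / sqrt b)
          \<le> (1 + \<theta> / 2 * ln b + u / sqrt b + 5 / 4) - a * y\<^sup>2"
        using 1 2 3 4 5 by linarith
      have "norm (of_real (real N powr (- \<theta> / 2)) * W N y) \<le>
         2 * exp ((1 + \<theta> / 2 * ln b + u / sqrt b + 5 / 4) - a * y\<^sup>2)"
        unfolding NW using near_A[OF Rq True] ex by (intro mult_mono) auto
      also have "\<dots> = Ka * exp (- (a * y\<^sup>2))" by (simp only: Ka_def mult.assoc mult_exp_exp add_uminus_conv_diff)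
      also have "\<dots> \<le> (Ka + Kb) * exp (- (a * y\<^sup>2))"
        using K1 by (intro mult_right_mono) (auto simp: Kb_def)
      finally show ?thesis .
    next
      case False
      have qQ: "q N y \<in> Q"
      proof -
        have "q N y \<in> slit_strip" by (rule q_in_strip) (use N' y in auto)
        moreover have "Re (q N y) \<le> 1"
        proof -
          have "1 \<le> sqrt b * sqrt (real N)"
            using N' b by (subst real_sqrt_mult[symmetric]) (simp add: field_simps)
          thus ?thesis using N' b by (simp add: Re_q field_simps)
        qed
        ultimately show ?thesis using False by (auto simp: Q_iff slit_strip_def)
      qed
      have 1: "- \<theta> / 2 * ln (real N) \<le> 0" using N' \<theta> by simp
      have "e N * Re (B (q N y)) \<le> e N * K1"
        using K1(3)[OF qQ] e_bounds[of N] complex_Re_le_cmod[of "B (q N y)"] by (intro mult_left_mono) auto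
      also have "\<dots> \<le> 1 * K1" using e_bounds[of N] K1(1) by (intro mult_right_mono) auto
      finally have 2: "e N * Re (B (q N y)) \<le> K1" by simp
      have "e N * real N * Re (C (q N y)) \<le> e N * real N * (- \<epsilon>)"
        using \<epsilon>(2)[OF qQ] e_bounds[of N] by (intro mult_left_mono) auto
      also have "\<dots> \<le> 1 / 2 * real N * (- \<epsilon>)"
        using N' \<epsilon> by (intro mult_right_mono_neg mult_right_mono) auto
      finally have 3: "e N * real N * Re (C (q N y)) \<le> - (\<epsilon> * real N / 2)" by (simp add: mult.commute)
      \<comment> \<open>Arithmetic-geometric mean inequality, weighted so that exactly half of the
        available \<open>\<epsilon> * N / 2\<close> is spent.\<close>
      have 4: "sqrt (real N) / sqrt b \<le> \<epsilon> * real N / 4 + 1 / (b * \<epsilon>)"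
      proof -
        have "0 \<le> (sqrt \<epsilon> * sqrt (real N) / 2 - 1 / (sqrt b * sqrt \<epsilon>))\<^sup>2" by simp
        also have "\<dots> = \<epsilon> * real N / 4 + 1 / (b * \<epsilon>) - sqrt (real N) / sqrt b"
          using b \<epsilon> by (simp add: power2_diff power_divide power_mult_distrib)
        finally show ?thesis by simp
      qed
      have "y\<^sup>2 \<le> (pi * sqrt (real N))\<^sup>2" using power_mono[OF y, of 2] by simp
      hence "a * y\<^sup>2 \<le> \<epsilon> / (4 * pi\<^sup>2) * (pi * sqrt (real N))\<^sup>2"
        using \<epsilon> by (intro mult_mono) (auto simp: a_def)
      hence 5: "a * y\<^sup>2 \<le> \<epsilon> * real N / 4" by (simp add: power_mult_distrib)
      have ex: "- \<theta> / 2 * ln (real N) + (e N * Re (B (q N y)) + e N * real N * Re (C (q N y)) + sqrt (real N) / sqrt b)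
          \<le> (K1 + 1 / (b * \<epsilon>)) - a * y\<^sup>2"
        using 1 2 3 4 5 by linarith
      have "norm (of_real (real N powr (- \<theta> / 2)) * W N y) \<le> K1 * exp ((K1 + 1 / (b * \<epsilon>)) - a * y\<^sup>2)"
        unfolding NW using K1(1) K1(2)[OF qQ] ex by (intro mult_mono) auto
      also have "\<dots> = Kb * exp (- (a * y\<^sup>2))" by (simp only: Kb_def mult.assoc mult_exp_exp add_uminus_conv_diff)
      also have "\<dots> \<le> (Ka + Kb) * exp (- (a * y\<^sup>2))"
        by (intro mult_right_mono) (auto simp: Ka_def)
      finally show ?thesis .
    qed
  qed
qed

text \<open>Under \<open>y \<mapsto> y / sqrt b\<close> the power yields
  \<open>b powr (\<theta> / 2)\<close>, the Jacobian \<open>1 / sqrt b\<close>, and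
  \<open>u * v\<close> becomes \<open>u / sqrt b\<close> times the new variable.\<close>

lemma Jline_rescale:
  "(LBINT y. v y powr (- of_real \<theta>) * exp (of_real b * (v y)\<^sup>2 + of_real u * v y))
     = of_real (b powr ((\<theta> - 1) / 2)) * Jline (u / sqrt b) \<theta>"
proof -
  have v: "v (0 + 1 / sqrt b * y) = of_real (1 / sqrt b) * (1 - \<i> * of_real y)" for y
    by (simp add: v_def algebra_simps)
  have p: "v (0 + 1 / sqrt b * y) powr (- of_real \<theta>) = of_real (b powr (\<theta> / 2)) * (1 - \<i> * of_real y) powr (- of_real \<theta>)" for y
  proof -
    have "v (0 + 1 / sqrt b * y) powr (- of_real \<theta>) = of_real (1 / sqrt b) powr (- of_real \<theta>) * (1 - \<i> * of_real y) powr (- of_real \<theta>)"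
      unfolding v using b by (intro powr_times_real_left) auto
    also have "complex_of_real (1 / sqrt b) powr (- of_real \<theta>) = of_real ((1 / sqrt b) powr (- \<theta>))"
      using b powr_of_real[of "1 / sqrt b" "- \<theta>"] by simp
    also have "(1 / sqrt b) powr (- \<theta>) = b powr (\<theta> / 2)"
      using b by (simp add: powr_half_sqrt[symmetric] powr_minus_divide[symmetric] powr_powr flip: powr_minus)
    finally show ?thesis .
  qed
  have "(LBINT y. v y powr (- of_real \<theta>) * exp (of_real b * (v y)\<^sup>2 + of_real u * v y)) =
     \<bar>1 / sqrt b\<bar> *\<^sub>R (LBINT y. v (0 + 1 / sqrt b * y) powr (- of_real \<theta>) *
        exp (of_real b * (v (0 + 1 / sqrt b * y))\<^sup>2 + of_real u * v (0 + 1 / sqrt b * y)))"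
    by (rule lborel_integral_real_affine) (use b in auto)
  also have "(\<lambda>y. v (0 + 1 / sqrt b * y) powr (- of_real \<theta>) *
        exp (of_real b * (v (0 + 1 / sqrt b * y))\<^sup>2 + of_real u * v (0 + 1 / sqrt b * y))) =
    (\<lambda>y. of_real (b powr (\<theta> / 2)) * ((1 - \<i> * of_real y) powr (- of_real \<theta>) *
      exp (of_real (u / sqrt b) * (1 - \<i> * of_real y) + (1 - \<i> * of_real y)\<^sup>2)))"
  proof
    fix y
    have "of_real b * (v (0 + 1 / sqrt b * y))\<^sup>2 + of_real u * v (0 + 1 / sqrt b * y) =
      of_real (u / sqrt b) * (1 - \<i> * of_real y) + (1 - \<i> * of_real y)\<^sup>2"
      unfolding v using b by (simp add: power_mult_distrib power_divide flip: of_real_power)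
    thus "v (0 + 1 / sqrt b * y) powr (- of_real \<theta>) *
        exp (of_real b * (v (0 + 1 / sqrt b * y))\<^sup>2 + of_real u * v (0 + 1 / sqrt b * y)) =
      of_real (b powr (\<theta> / 2)) * ((1 - \<i> * of_real y) powr (- of_real \<theta>) *
      exp (of_real (u / sqrt b) * (1 - \<i> * of_real y) + (1 - \<i> * of_real y)\<^sup>2))"
      unfolding p by (simp only: mult.assoc)
  qed
  also have "\<bar>1 / sqrt b\<bar> *\<^sub>R (LBINT y. of_real (b powr (\<theta> / 2)) * ((1 - \<i> * of_real y) powr (- of_real \<theta>) *
      exp (of_real (u / sqrt b) * (1 - \<i> * of_real y) + (1 - \<i> * of_real y)\<^sup>2))) =
      of_real (b powr (\<theta> / 2) / sqrt b) * Jline (u / sqrt b) \<theta>"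
    using b by (simp add: Jline_def scaleR_conv_of_real)
  also have "b powr (\<theta> / 2) / sqrt b = b powr ((\<theta> - 1) / 2)"
    using b by (simp add: powr_half_sqrt[symmetric] diff_divide_distrib powr_diff)
  finally show ?thesis .
qed

text \<open>Dominated convergence on windows that exhaust the line. The sequence is shifted by
  \<open>N1\<close> because the majorant must hold for every member.\<close>

lemma W_integral_tendsto:
  "(\<lambda>N. LBINT y. indicator {- pi * sqrt (real N)..pi * sqrt (real N)} y *\<^sub>R (of_real (real N powr (- \<theta> / 2)) * W N y))
     \<longlonglongrightarrow> of_real (b powr ((\<theta> - 1) / 2)) * Jline (u / sqrt b) \<theta>"
proof -
  obtain K a N0 where K: "a > 0"
    "\<And>N y. N \<ge> N0 \<Longrightarrow> \<bar>y\<bar> \<le> pi * sqrt (real N) \<Longrightarrow>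
       norm (of_real (real N powr (- \<theta> / 2)) * W N y) \<le> K * exp (- (a * y\<^sup>2))"
    by (rule W_dominated) blast
  define N1 where "N1 = max N0 1"
  let ?S = "\<lambda>N y. indicator {- pi * sqrt (real N)..pi * sqrt (real N)} y *\<^sub>R (of_real (real N powr (- \<theta> / 2)) * W N y)"
  have cont_v: "continuous_on UNIV v" unfolding v_def by (intro continuous_intros)
  have "(\<lambda>N. LBINT y. ?S (N + N1) y) \<longlonglongrightarrow> (LBINT y. v y powr (- of_real \<theta>) * exp (of_real b * (v y)\<^sup>2 + of_real u * v y))"
  proof (rule integral_dominated_convergence)
    show "integrable lborel (\<lambda>y. \<bar>K\<bar> * exp (- (a * y\<^sup>2)))"
      by (intro integrable_mult_right integrable_gauss K)
    have "continuous_on UNIV (\<lambda>y. v y powr (- of_real \<theta>) * exp (of_real b * (v y)\<^sup>2 + of_real u * v y))"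
      using b by (intro continuous_intros cont_v) (auto simp: complex_nonpos_Reals_iff Re_v)
    thus "(\<lambda>y. v y powr (- of_real \<theta>) * exp (of_real b * (v y)\<^sup>2 + of_real u * v y)) \<in> borel_measurable lborel"
      by (simp add: borel_measurable_continuous_onI)
    \<comment> \<open>Continuity of the integrand is known only where \<open>q\<close> lies in the
      strip, so measurability is derived on the compact window cut out by the indicator.\<close>
    show "?S (N + N1) \<in> borel_measurable lborel" for N
    proof -
      let ?n = "N + N1"
      have n: "?n > 0" by (auto simp: N1_def max_def)
      have sub: "q ?n ` {- pi * sqrt (real ?n)..pi * sqrt (real ?n)} \<subseteq> slit_strip"
        using q_in_strip[OF n] by (auto simp: abs_le_iff)
      have cq: "continuous_on {- pi * sqrt (real ?n)..pi * sqrt (real ?n)} (q ?n)"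
        unfolding q_def using n by (intro continuous_intros continuous_on_subset[OF cont_v]) auto
      have "continuous_on {- pi * sqrt (real ?n)..pi * sqrt (real ?n)} (\<lambda>y. of_real (real ?n powr (- \<theta> / 2)) * W ?n y)"
        unfolding W_def
        by (intro continuous_intros continuous_on_compose2[OF cont(1) cq sub] continuous_on_compose2[OF cont(2) cq sub]
            continuous_on_compose2[OF cont(3) cq sub] continuous_on_subset[OF cont_v]) auto
      thus ?thesis
        unfolding measurable_lborel2 by (intro borel_measurable_continuous_on_indicator) auto
    qed
    show "AE y in lborel. (\<lambda>N. ?S (N + N1) y) \<longlonglongrightarrow> v y powr (- of_real \<theta>) * exp (of_real b * (v y)\<^sup>2 + of_real u * v y)"
    proof (intro AE_I2 LIMSEQ_ignore_initial_segment)
      fix y :: real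
      have "eventually (\<lambda>N. \<bar>y\<bar> \<le> pi * sqrt (real N)) sequentially" by real_asymp
      hence "eventually (\<lambda>N. of_real (real N powr (- \<theta> / 2)) * W N y = ?S N y) sequentially"
        by eventually_elim (auto simp: indicator_def abs_le_iff)
      thus "(\<lambda>N. ?S N y) \<longlonglongrightarrow> v y powr (- of_real \<theta>) * exp (of_real b * (v y)\<^sup>2 + of_real u * v y)"
        by (rule Lim_transform_eventually[OF W_tendsto])
    qed
    show "AE y in lborel. norm (?S (N + N1) y) \<le> \<bar>K\<bar> * exp (- (a * y\<^sup>2))" for N
    proof (intro AE_I2)
      fix y :: real
      have le: "K * exp (- (a * y\<^sup>2)) \<le> \<bar>K\<bar> * exp (- (a * y\<^sup>2))" by (intro mult_right_mono) auto
      have n: "N + N1 \<ge> N0" by (simp add: N1_def)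
      show "norm (?S (N + N1) y) \<le> \<bar>K\<bar> * exp (- (a * y\<^sup>2))"
      proof (cases "y \<in> {- pi * sqrt (real (N + N1))..pi * sqrt (real (N + N1))}")
        case True
        hence "\<bar>y\<bar> \<le> pi * sqrt (real (N + N1))" by (auto simp: abs_le_iff)
        from order_trans[OF K(2)[OF n this] le] True show ?thesis
          by (simp only: indicator_simps scaleR_one)
      next
        case False
        thus ?thesis by (simp add: indicator_def del: atLeastAtMost_iff)
      qed
    qed
  qed
  hence "(\<lambda>N. LBINT y. ?S N y) \<longlonglongrightarrow> (LBINT y. v y powr (- of_real \<theta>) * exp (of_real b * (v y)\<^sup>2 + of_real u * v y))"
    by (rule LIMSEQ_offset)
  thus ?thesis by (simp only: Jline_rescale)
qed

end

section \<open>Cauchy's coefficient formula in exponential coordinates\<close>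

lemma has_integral_shift_period:
  fixes g :: "real \<Rightarrow> complex"
  assumes cont: "continuous_on UNIV g" and per: "\<And>t. g (t + 2 * pi) = g t"
    and I: "(g has_integral I) {0..2 * pi}"
  shows "(g has_integral I) {-pi..pi}"
proof -
  have int: "g integrable_on {a..b}" for a b
    by (rule integrable_continuous_interval) (rule continuous_on_subset[OF cont], simp)
  have "((\<lambda>t. g (t + 2 * pi)) has_integral integral {pi..2 * pi} g) {-pi..0}"
    using has_integral_affinity[of g "integral {pi..2*pi} g" pi "2*pi" 1 "2*pi"] int[of pi "2*pi"]
    by (simp add: has_integral_integrable_integral)
  hence 1: "(g has_integral integral {pi..2 * pi} g) {-pi..0}" by (simp add: per)
  have "(g has_integral integral {0..pi} g) {0..pi}" using int by (simp add: has_integral_integrable_integral)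
  hence "(g has_integral (integral {pi..2 * pi} g + integral {0..pi} g)) {-pi..pi}"
    by (intro has_integral_combine[of "-pi" 0 pi] 1) auto
  also have "integral {pi..2 * pi} g + integral {0..pi} g = integral {0..2 * pi} g"
    using Henstock_Kurzweil_Integration.integral_combine[of 0 pi "2*pi" g] int by (simp add: add.commute)
  also have "\<dots> = I" using I by (rule integral_unique)
  finally show ?thesis .
qed

text \<open>The standard circle is parametrised over \<open>[0, 2 * pi]\<close>, with the critical
  direction \<open>t = 0\<close> at its ends; by periodicity the window is recentred so that this
  direction lies in the middle.\<close>

lemma zcoeff_conv_integral:
  assumes hol: "F holomorphic_on ball 0 R" and r: "0 < r" "r < R"
  shows "zcoeff N F = 1 / (2 * pi) * (LBINT t. indicator {-pi..pi} t *\<^sub>R (F (of_real r * cis t) / (of_real r * cis t) ^ N))"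
proof -
  define g where "g = (\<lambda>t. F (of_real r * cis t) / (of_real r * cis t) ^ N)"
  have "continuous_on (cball 0 r) F" "F holomorphic_on ball 0 r"
    using hol r by (auto intro!: holomorphic_on_imp_continuous_on elim!: holomorphic_on_subset)
  hence "((\<lambda>u. F u / (u - 0) ^ Suc N) has_contour_integral (2 * pi * \<i>) / (fact N) * (deriv ^^ N) F 0) (circlepath 0 r)"
    by (rule Cauchy_has_contour_integral_higher_derivative_circlepath) (use r in auto)
  hence "((\<lambda>t. F (0 + of_real r * cis t) / (0 + of_real r * cis t - 0) ^ Suc N * of_real r * \<i> * cis t) has_integral
            (2 * pi * \<i>) / (fact N) * (deriv ^^ N) F 0) {0..2 * pi}"
    unfolding circlepath_def by (subst (asm) has_contour_integral_part_circlepath_iff) auto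
  also have "(\<lambda>t. F (0 + of_real r * cis t) / (0 + of_real r * cis t - 0) ^ Suc N * of_real r * \<i> * cis t) = (\<lambda>t. \<i> * g t)"
    using r by (auto simp: g_def fun_eq_iff field_simps)
  also have "(2 * pi * \<i>) / (fact N) * (deriv ^^ N) F 0 = \<i> * (2 * of_real pi * zcoeff N F)"
    by (simp add: zcoeff_def)
  finally have "((\<lambda>t. \<i> * g t) has_integral \<i> * (2 * of_real pi * zcoeff N F)) {0..2 * pi}" .
  from has_integral_mult_right[OF this, of "- \<i>"]
  have "(g has_integral (2 * of_real pi * zcoeff N F)) {0..2 * pi}"
    by (simp flip: mult.assoc)
  moreover have contg: "continuous_on UNIV g"
    unfolding g_def
    by (intro continuous_intros continuous_on_compose2[OF holomorphic_on_imp_continuous_on[OF hol]])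
       (use r in \<open>auto simp: norm_mult\<close>)
  moreover have "g (t + 2 * pi) = g t" for t
    by (simp add: g_def flip: cis_mult)
  ultimately have hi: "(g has_integral (2 * of_real pi * zcoeff N F)) {-pi..pi}"
    by (intro has_integral_shift_period) auto
  have "set_integrable lborel {-pi..pi} g"
    using borel_integrable_atLeastAtMost'[of "-pi" pi g] continuous_on_subset[OF contg] by auto
  from set_borel_integral_eq_integral(2)[OF this] hi
  have "(LBINT t:{-pi..pi}. g t) = 2 * of_real pi * zcoeff N F" by (simp add: integral_unique)
  thus ?thesis by (simp add: g_def set_lebesgue_integral_def)
qed

text \<open>Radius \<open>R * exp (- c / s)\<close> and angle \<open>t = y / s\<close>. With
  \<open>s = sqrt N\<close> the Jacobian \<open>1 / s\<close> accounts for the \<open>- 1\<close> in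
  the exponent \<open>(theta_star - 1) / 2\<close> of \<open>N\<close>.\<close>

lemma zcoeff_conv_integral_exp:
  assumes hol: "F holomorphic_on ball 0 R" and R: "R > 0" and c: "c > 0" and s: "s > 0"
  shows "zcoeff N F = 1 / (2 * pi * s * R ^ N) *
     (LBINT y. indicator {-pi * s..pi * s} y *\<^sub>R
        (F (of_real R * exp (- ((of_real c - \<i> * of_real y) / of_real s))) *
           exp (of_nat N * ((of_real c - \<i> * of_real y) / of_real s))))"
proof -
  define r where "r = R * exp (- c / s)"
  have r: "0 < r" "r < R" using R c s by (auto simp: r_def)
  define g where "g = (\<lambda>t. indicator {-pi..pi} t *\<^sub>R (F (of_real r * cis t) / (of_real r * cis t) ^ N))"
  have "zcoeff N F = 1 / (2 * pi) * (LBINT t. g t)"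
    unfolding g_def by (rule zcoeff_conv_integral[OF hol r])
  also have "(LBINT t. g t) = \<bar>1 / s\<bar> *\<^sub>R (LBINT y. g (0 + 1 / s * y))"
    by (rule lborel_integral_real_affine) (use s in auto)
  also have "(\<lambda>y. g (0 + 1 / s * y)) = (\<lambda>y. (1 / of_real R ^ N) * (indicator {-pi * s..pi * s} y *\<^sub>R
        (F (of_real R * exp (- ((of_real c - \<i> * of_real y) / of_real s))) *
           exp (of_nat N * ((of_real c - \<i> * of_real y) / of_real s)))))"
  proof
    fix y
    have z: "of_real r * cis (0 + 1 / s * y) = of_real R * exp (- ((of_real c - \<i> * of_real y) / of_real s))"
      by (simp add: r_def cis_conv_exp diff_divide_distrib exp_add exp_diff exp_minus field_simps flip: exp_of_real)
    have i: "indicator {-pi..pi} (0 + 1 / s * y) = (indicator {-pi * s..pi * s} y :: real)"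
      using s by (auto simp: indicator_def field_simps)
    have e: "exp (- x) ^ N = 1 / exp (of_nat N * x)" for x :: complex
      by (simp add: exp_of_nat_mult exp_minus divide_inverse power_inverse)
    show "g (0 + 1 / s * y) = (1 / of_real R ^ N) * (indicator {-pi * s..pi * s} y *\<^sub>R
        (F (of_real R * exp (- ((of_real c - \<i> * of_real y) / of_real s))) *
           exp (of_nat N * ((of_real c - \<i> * of_real y) / of_real s))))"
      unfolding g_def z i unfolding power_mult_distrib e by (simp add: scaleR_conv_of_real)
  qed
  finally show ?thesis using s by (simp add: scaleR_conv_of_real)
qed

section \<open>The boundary behaviour of the generating functions\<close>

lemma gfun_sums_Re:
  assumes "conv_radius (gcoeffs a) = ereal R" "norm z < R"
  shows "(\<lambda>i. a i / real i * Re (z ^ i)) sums Re (gfun a z)"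
proof -
  have "summable (\<lambda>i. gcoeffs a i * z ^ i)"
    by (rule summable_in_conv_radius) (use assms in auto)
  hence "(\<lambda>i. complex_of_real (a i / real i) * z ^ i) sums gfun a z"
    unfolding gfun_def gcoeffs_def by (rule summable_sums)
  from sums_Re[OF this] show ?thesis by (simp only: times_complex.sel Re_complex_of_real Im_complex_of_real mult_zero_left diff_zero)
qed

lemma gfun_of_real_in_Reals:
  assumes "conv_radius (gcoeffs a) = ereal R" "\<bar>r\<bar> < R"
  shows "Im (gfun a (of_real r)) = 0"
proof -
  have "summable (\<lambda>i. gcoeffs a i * of_real r ^ i)"
    by (rule summable_in_conv_radius) (use assms in auto)
  hence "(\<lambda>i. complex_of_real (a i / real i) * of_real r ^ i) sums gfun a (of_real r)"
    unfolding gfun_def gcoeffs_def by (rule summable_sums)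
  from sums_Im[OF this] have "(\<lambda>i. 0) sums Im (gfun a (of_real r))" by (simp flip: of_real_power)
  thus ?thesis using sums_unique2 sums_zero by blast
qed

text \<open>Since \<open>Re (z ^ i) \<le> r ^ i\<close>, the difference of the two series has
  nonnegative terms, and any one of them is a lower bound for the sum.\<close>

lemma Re_gfun_le:
  assumes "\<And>j. a j \<ge> 0" "conv_radius (gcoeffs a) = ereal R" "norm z \<le> r" "r < R"
  shows "Re (gfun a z) \<le> Re (gfun a (of_real r)) - a j / real j * (r ^ j - Re (z ^ j))"
proof -
  have r0: "0 \<le> r" using assms(3) norm_ge_zero order_trans by blast
  have "(\<lambda>i. a i / real i * r ^ i) sums Re (gfun a (of_real r))"
    using gfun_sums_Re[OF assms(2), of "of_real r"] assms r0 by (simp flip: of_real_power)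
  moreover have "(\<lambda>i. a i / real i * Re (z ^ i)) sums Re (gfun a z)"
    using assms by (intro gfun_sums_Re) auto
  ultimately have "(\<lambda>i. a i / real i * (r ^ i - Re (z ^ i))) sums (Re (gfun a (of_real r)) - Re (gfun a z))"
    by (auto simp: right_diff_distrib intro: sums_diff)
  moreover have nn: "a i / real i * (r ^ i - Re (z ^ i)) \<ge> 0" for i
  proof -
    have "Re (z ^ i) \<le> norm z ^ i" using complex_Re_le_cmod[of "z ^ i"] by (simp add: norm_power)
    also have "\<dots> \<le> r ^ i" using assms(3) by (intro power_mono) auto
    finally show ?thesis using assms(1)[of i] by (intro mult_nonneg_nonneg) auto
  qed
  ultimately have "sum (\<lambda>i. a i / real i * (r ^ i - Re (z ^ i))) {j} \<le> Re (gfun a (of_real r)) - Re (gfun a z)"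
    by (metis (no_types, lifting) finite.emptyI finite.insertI sum_le_suminf sums_iff)
  thus ?thesis by simp
qed

text \<open>The multiplicative order of \<open>w\<close> divides every index in the support of
  \<open>a\<close>; an order above \<open>1\<close> would be a forbidden common divisor.\<close>

lemma root_of_unity_support:
  fixes w :: complex
  assumes "\<not> (\<exists>j0::nat. j0 > 1 \<and> (\<forall>j\<ge>1. a j \<noteq> (0::real) \<longrightarrow> j0 dvd j))"
    and "\<exists>j\<ge>1. a j \<noteq> 0" and w: "\<And>j. j \<ge> 1 \<Longrightarrow> a j \<noteq> 0 \<Longrightarrow> w ^ j = 1"
  shows "w = 1"
proof -
  define n where "n = (LEAST n. n \<ge> 1 \<and> w ^ n = 1)"
  have ex: "\<exists>n\<ge>1. w ^ n = 1" using assms(2) w by blast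
  have n: "n \<ge> 1" "w ^ n = 1" using LeastI_ex[OF ex] by (auto simp: n_def)
  have "n dvd j" if "j \<ge> 1" "a j \<noteq> 0" for j
  proof -
    have "w ^ j = w ^ (n * (j div n) + j mod n)" by simp
    also have "\<dots> = w ^ (j mod n)" unfolding power_add power_mult n(2) by simp
    finally have "w ^ (j mod n) = 1" using w that by simp
    moreover have "j mod n < n" using n by simp
    ultimately have "j mod n = 0"
      using not_less_Least[of "j mod n" "\<lambda>n. n \<ge> 1 \<and> w ^ n = 1"] by (auto simp: n_def)
    thus ?thesis by auto
  qed
  hence "\<not> n > 1" using assms(1) by blast
  thus ?thesis using n by (cases "n = 1") auto
qed

text \<open>Subtracting a single term of the series before passing to the boundary
  avoids any discussion of convergence on the circle itself.\<close>

lemma Re_less_on_closed_disc: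
  assumes nonneg: "\<And>j. a j \<ge> 0" and rad: "conv_radius (gcoeffs a) = ereal R" and R: "R > 0"
    and non_arith: "\<not> (\<exists>j0::nat. j0 > 1 \<and> (\<forall>j\<ge>1. a j \<noteq> 0 \<longrightarrow> j0 dvd j))"
    and pos: "\<exists>j\<ge>2. a j > 0"
    and G: "\<And>z. norm z < R \<Longrightarrow> G z = gfun a z" "continuous_on (cball 0 R - {of_real R}) G"
    and lim: "(\<lambda>n. Re (gfun a (of_real (r n)))) \<longlonglongrightarrow> M" "r \<longlonglongrightarrow> R" "\<And>n. r n < R"
    and z: "norm z \<le> R" "z \<noteq> of_real R"
  shows "Re (G z) < M"
proof (rule ccontr)
  assume "\<not> Re (G z) < M"
  hence M: "M \<le> Re (G z)" by simp
  have inner: "Re (gfun a w) \<le> M - a j / real j * (R ^ j - Re (w ^ j))" if "norm w < R" for w j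
  proof (rule tendsto_le[OF sequentially_bot _ tendsto_const])
    show "(\<lambda>n. Re (gfun a (of_real (r n))) - a j / real j * (r n ^ j - Re (w ^ j))) \<longlonglongrightarrow> M - a j / real j * (R ^ j - Re (w ^ j))"
      by (intro tendsto_intros lim)
    have "eventually (\<lambda>n. r n > norm w) sequentially" using order_tendstoD(1)[OF lim(2) that] .
    thus "eventually (\<lambda>n. Re (gfun a w) \<le> Re (gfun a (of_real (r n))) - a j / real j * (r n ^ j - Re (w ^ j))) sequentially"
      by eventually_elim (use Re_gfun_le[OF nonneg rad] lim(3) in \<open>auto intro: less_imp_le\<close>)
  qed
  have bound: "Re (G z) \<le> M - a j / real j * (R ^ j - Re (z ^ j))" for j
  proof -
    \<comment> \<open>Radial approach to a possible boundary point \<open>z\<close>; the offset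
      \<open>2\<close> keeps every factor strictly between \<open>0\<close> and
      \<open>1\<close>.\<close>
    define t where "t = (\<lambda>n. 1 - 1 / real (n + 2))"
    have t: "t \<longlonglongrightarrow> 1" unfolding t_def by real_asymp
    have t01: "0 < t n" "t n < 1" for n by (auto simp: t_def)
    have tz: "norm (of_real (t n) * z) < R" for n
    proof -
      have "norm (of_real (t n) * z) = t n * norm z" using t01[of n] by (simp add: norm_mult)
      also have "\<dots> \<le> t n * R" using t01[of n] z by (intro mult_left_mono) auto
      also have "\<dots> < 1 * R" using t01[of n] R by (intro mult_strict_right_mono) auto
      finally show ?thesis by simp
    qed
    have lz: "(\<lambda>n. of_real (t n) * z) \<longlonglongrightarrow> z"
      using tendsto_mult[OF tendsto_of_real[OF t, where 'a = complex] tendsto_const[of z]] by simp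
    have "(\<lambda>n. G (of_real (t n) * z)) \<longlonglongrightarrow> G z"
    proof (rule continuous_on_tendsto_compose[OF G(2) lz])
      show "z \<in> cball 0 R - {of_real R}" using z by auto
      have "of_real (t n) * z \<noteq> of_real R" for n using tz[of n] R by auto
      thus "eventually (\<lambda>n. of_real (t n) * z \<in> cball 0 R - {of_real R}) sequentially"
        using tz by (auto intro!: always_eventually less_imp_le)
    qed
    hence 1: "(\<lambda>n. Re (G (of_real (t n) * z))) \<longlonglongrightarrow> Re (G z)" by (rule tendsto_Re)
    have 2: "(\<lambda>n. M - a j / real j * (R ^ j - Re ((of_real (t n) * z) ^ j))) \<longlonglongrightarrow> M - a j / real j * (R ^ j - Re (z ^ j))"
      by (intro tendsto_intros lz)
    show ?thesis
      by (rule tendsto_le[OF sequentially_bot 2 1]) (use inner tz G(1) in auto)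
  qed
  \<comment> \<open>Equality would force \<open>Re (z ^ j) = R ^ j\<close> for each index in the
    support. As the modulus is at most \<open>R ^ j\<close>, the imaginary part vanishes and
    \<open>z / R\<close> is a root of unity of order dividing \<open>j\<close>.\<close>
  have "(z / of_real R) ^ j = 1" if j: "j \<ge> 1" "a j \<noteq> 0" for j
  proof -
    have aj: "a j > 0" using nonneg[of j] j by linarith
    hence aj': "a j / real j > 0" using j by simp
    have le: "a j / real j * (R ^ j - Re (z ^ j)) \<le> 0" using bound[of j] M by linarith
    have "R ^ j \<le> Re (z ^ j)"
    proof (rule ccontr)
      assume "\<not> R ^ j \<le> Re (z ^ j)"
      hence "R ^ j - Re (z ^ j) > 0" by simp
      from mult_pos_pos[OF aj' this] le show False by linarith
    qed
    moreover have "norm (z ^ j) \<le> R ^ j" using z by (simp add: norm_power power_mono)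
    ultimately have *: "Re (z ^ j) = R ^ j" "norm (z ^ j) = R ^ j" using complex_Re_le_cmod[of "z ^ j"] by auto
    have "(norm (z ^ j))\<^sup>2 = (Re (z ^ j))\<^sup>2 + (Im (z ^ j))\<^sup>2" by (rule cmod_power2)
    hence "Im (z ^ j) = 0" unfolding * by simp
    with *(1) have "z ^ j = of_real (R ^ j)" by (simp add: complex_eq_iff flip: of_real_power)
    thus ?thesis using R by (simp add: power_divide)
  qed
  moreover have "\<exists>j\<ge>1. a j \<noteq> 0"
  proof -
    from pos obtain j where "j \<ge> 2" "a j > 0" by blast
    thus ?thesis by (intro exI[of _ j]) auto
  qed
  ultimately have "z / of_real R = 1" using root_of_unity_support[OF non_arith] by blast
  thus False using z R by simp
qed

section \<open>Local expansions at the singularity in the coordinate \<open>q\<close>\<close>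

abbreviation rhp0 :: "complex filter" where "rhp0 \<equiv> at 0 within {q. Re q > 0}"

lemma eventually_rhp0: "eventually (\<lambda>q. Re q > 0) rhp0"
  by (auto simp: eventually_at_filter)

text \<open>These translate expansions in \<open>1 - z / R = 1 - exp (- q)\<close> into expansions
  in \<open>q\<close>. The first is a Taylor remainder estimate; for the third, \<open>q\<close> and
  the quotient both have positive real part eventually, so the logarithms split without a jump of
  \<open>2 * pi * \<i>\<close>.\<close>

lemma one_minus_exp_limits:
  "((\<lambda>q. (q - (1 - exp (- q)) - q\<^sup>2 / 2) / q\<^sup>2) \<longlongrightarrow> 0) rhp0"
  "((\<lambda>q. (1 - exp (- q)) / q) \<longlongrightarrow> 1) rhp0"
  "((\<lambda>q. Ln (1 - exp (- q)) - Ln q) \<longlongrightarrow> 0) rhp0"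
proof -
  show 1: "((\<lambda>q. (q - (1 - exp (- q)) - q\<^sup>2 / 2) / q\<^sup>2) \<longlongrightarrow> 0) rhp0"
  proof (rule Lim_null_comparison)
    show "eventually (\<lambda>q. norm ((q - (1 - exp (- q)) - q\<^sup>2 / 2) / q\<^sup>2) \<le> exp \<bar>Re q\<bar> * norm q / 2) rhp0"
      using eventually_rhp0
    proof eventually_elim
      case (elim q)
      hence "q \<noteq> 0" by auto
      have eq: "q - (1 - exp (- q)) - q\<^sup>2 / 2 = exp (- q) - (\<Sum>k\<le>2. (- q) ^ k / fact k)"
        by (simp add: eval_nat_numeral)
      have "norm (q - (1 - exp (- q)) - q\<^sup>2 / 2) \<le> exp \<bar>Re q\<bar> * norm q ^ 3 / 2"
        using Taylor_exp[of "- q" 2] unfolding eq by (simp add: fact_numeral)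
      also have "\<dots> = exp \<bar>Re q\<bar> * norm q / 2 * norm q ^ 2" by (simp add: power3_eq_cube power2_eq_square)
      finally show ?case using \<open>q \<noteq> 0\<close> by (simp add: norm_divide norm_power divide_le_eq)
    qed
    have "((\<lambda>q. exp \<bar>Re q\<bar> * norm q / 2) \<longlongrightarrow> exp \<bar>Re 0\<bar> * norm (0::complex) / 2) rhp0"
      by (intro tendsto_intros) auto
    thus "((\<lambda>q. exp \<bar>Re q\<bar> * norm q / 2) \<longlongrightarrow> 0) rhp0" by simp
  qed
  have "((\<lambda>q. 1 - q / 2 - q * ((q - (1 - exp (- q)) - q\<^sup>2 / 2) / q\<^sup>2)) \<longlongrightarrow> 1 - 0 / 2 - 0 * 0) rhp0"
    by (intro tendsto_intros 1) auto
  hence "((\<lambda>q. 1 - q / 2 - q * ((q - (1 - exp (- q)) - q\<^sup>2 / 2) / q\<^sup>2)) \<longlongrightarrow> 1) rhp0" by simp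
  moreover have "eventually (\<lambda>q. 1 - q / 2 - q * ((q - (1 - exp (- q)) - q\<^sup>2 / 2) / q\<^sup>2) = (1 - exp (- q)) / q) rhp0"
    using eventually_rhp0
  proof eventually_elim
    case (elim q)
    hence "q \<noteq> 0" by auto
    have "1 - q / 2 - q * ((q - y - q\<^sup>2 / 2) / q\<^sup>2) = y / q" for y
      using \<open>q \<noteq> 0\<close> by (simp add: field_simps power2_eq_square)
    thus ?case .
  qed
  ultimately show 2: "((\<lambda>q. (1 - exp (- q)) / q) \<longlongrightarrow> 1) rhp0"
    by (rule Lim_transform_eventually)
  have "((\<lambda>q. Ln ((1 - exp (- q)) / q)) \<longlongrightarrow> Ln 1) rhp0"
    by (rule tendsto_Ln[OF 2]) (auto simp: complex_nonpos_Reals_iff)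
  moreover have "eventually (\<lambda>q. Ln ((1 - exp (- q)) / q) = Ln (1 - exp (- q)) - Ln q) rhp0"
    using eventually_rhp0 order_tendstoD(1)[OF tendsto_Re[OF 2], of 0, simplified]
  proof eventually_elim
    case (elim q)
    define w where "w = (1 - exp (- q)) / q"
    have "q \<noteq> 0" "w \<noteq> 0" using elim by (auto simp: w_def)
    have "\<bar>Im (Ln q)\<bar> < pi / 2" "\<bar>Im (Ln w)\<bar> < pi / 2"
      using Re_Ln_pos_lt[of q] Re_Ln_pos_lt[of w] elim \<open>q \<noteq> 0\<close> \<open>w \<noteq> 0\<close> by (auto simp: w_def)
    hence "Ln (q * w) = Ln q + Ln w"
      using \<open>q \<noteq> 0\<close> \<open>w \<noteq> 0\<close> by (intro Ln_times_simple) linarith+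
    thus ?case using \<open>q \<noteq> 0\<close> by (simp add: w_def)
  qed
  ultimately show "((\<lambda>q. Ln (1 - exp (- q)) - Ln q) \<longlongrightarrow> 0) rhp0"
    unfolding Ln_1 by (rule Lim_transform_eventually)
qed

lemma tendsto_norm_one_minus_exp: "((\<lambda>q. norm (1 - exp (- q :: complex))) \<longlongrightarrow> 0) rhp0"
proof -
  have "((\<lambda>q. norm (1 - exp (- q :: complex))) \<longlongrightarrow> norm (1 - exp (- 0 :: complex))) rhp0"
    by (intro tendsto_intros)
  thus ?thesis by simp
qed

text \<open>\<open>phi < pi / 2\<close> makes the outer radius at least
  \<open>R * (1 + eta * cos phi) > R\<close>, and a point of the closed disc other than
  \<open>R\<close> has \<open>Re (z - R) < 0\<close>, hence an argument beyond
  \<open>pi / 2 > phi\<close>.\<close>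

lemma norm_le_R_in_Delta0:
  assumes R: "R > 0" and eta: "eta > 0" and phi: "0 < phi" "phi < pi / 2"
    and z: "norm z \<le> R" "z \<noteq> of_real R"
  shows "z \<in> Delta0 R eta phi"
proof -
  have "1 < 1 + eta * cos phi" using eta phi cos_gt_zero_pi[of phi] by simp
  also have "\<dots> = Re (1 + of_real eta * cis phi)" by simp
  also have "\<dots> \<le> norm (1 + of_real eta * cis phi)" by (rule complex_Re_le_cmod)
  finally have "R * 1 < R * norm (1 + of_real eta * cis phi)" using R by (intro mult_strict_left_mono)
  moreover have "\<bar>Arg (z - of_real R)\<bar> > phi"
  proof -
    have "Re z < R"
    proof (rule ccontr)
      assume *: "\<not> Re z < R"
      hence "Re z = R" using z(1) complex_Re_le_cmod[of z] by simp
      moreover have "(Re z)\<^sup>2 + (Im z)\<^sup>2 \<le> R\<^sup>2"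
        using z(1) R by (metis cmod_power2 norm_ge_zero power_mono)
      ultimately have "Im z = 0" by simp
      thus False using \<open>Re z = R\<close> z(2) by (simp add: complex_eq_iff)
    qed
    hence "\<not> \<bar>Im (Ln (z - of_real R))\<bar> \<le> pi / 2"
      using z(2) by (subst Re_Ln_pos_le) auto
    thus ?thesis using phi z(2) by (simp add: Arg_eq_Im_Ln)
  qed
  ultimately show ?thesis using z by (simp add: Delta0_def)
qed

lemma exp_slit_strip:
  assumes "q \<in> slit_strip" "R > 0"
  shows "norm (of_real R * exp (- q)) \<le> R" "of_real R * exp (- q) \<noteq> of_real R"
proof -
  show "norm (of_real R * exp (- q)) \<le> R"
    using assms by (simp add: norm_mult norm_exp_eq_Re slit_strip_def)
  have "exp (- q) \<noteq> 1"
  proof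
    assume "exp (- q) = 1"
    then obtain n :: int where n: "Re q = 0" "Im q = of_int (2 * n) * pi"
      unfolding exp_eq_1 by (metis add.inverse_inverse minus_zero mult_minus_left of_int_minus mult_minus_right uminus_complex.sel)
    have "\<bar>of_int n\<bar> * (2 * pi) \<le> 1 * pi" using assms n by (simp add: slit_strip_def abs_mult)
    hence "\<bar>of_int n\<bar> * 2 \<le> (1 :: real)" by (subst (asm) mult.assoc[symmetric]) (simp only: mult_le_cancel_right_pos pi_gt_zero)
    hence "n = 0" by linarith
    thus False using n assms by (auto simp: slit_strip_def complex_eq_iff)
  qed
  thus "of_real R * exp (- q) \<noteq> of_real R" using assms by simp
qed

text \<open>As \<open>q\<close> tends to \<open>0\<close> in the right half-plane,
  \<open>R * exp (- q)\<close> tends to \<open>R\<close> within \<open>D\<close> and avoids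
  \<open>R\<close>, so the estimate pulls back. For a real exponent the modulus of the complex power
  is the real power of the modulus.\<close>

lemma bigo_transfer_rhp0:
  assumes F: "F \<in> bigo (at (of_real R) within D) (\<lambda>z. (1 - z / of_real R) powr of_real d)"
    and R: "R > 0" and D: "\<And>q. q \<in> slit_strip \<Longrightarrow> of_real R * exp (- q) \<in> D"
  obtains c where "c > 0"
    "eventually (\<lambda>q. norm (F (of_real R * exp (- q))) \<le> c * norm (1 - exp (- q)) powr d) rhp0"
proof -
  from F obtain c where c: "c > 0"
    "eventually (\<lambda>z. norm (F z) \<le> c * norm ((1 - z / of_real R) powr of_real d)) (at (of_real R) within D)"
    by (elim landau_o.bigE)
  have "filterlim (\<lambda>q. of_real R * exp (- q)) (at (of_real R) within D) rhp0"
    unfolding filterlim_at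
  proof
    have "eventually (\<lambda>q. dist q 0 < pi) rhp0"
      by (rule tendstoD[OF tendsto_ident_at]) simp
    with eventually_rhp0 have "eventually (\<lambda>q. q \<in> slit_strip) rhp0"
    proof eventually_elim
      case (elim q)
      thus ?case using abs_Im_le_cmod[of q] by (auto simp: slit_strip_def)
    qed
    thus "eventually (\<lambda>q. of_real R * exp (- q) \<in> D \<and> of_real R * exp (- q) \<noteq> of_real R) rhp0"
      by eventually_elim (use D exp_slit_strip R in auto)
    have "((\<lambda>q. of_real R * exp (- q)) \<longlongrightarrow> of_real R * exp (- 0 :: complex)) rhp0"
      by (intro tendsto_intros)
    thus "((\<lambda>q. of_real R * exp (- q :: complex)) \<longlongrightarrow> of_real R) rhp0" by simp
  qed
  from filterlim_iff[THEN iffD1, OF this, rule_format, OF c(2)]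
  have "eventually (\<lambda>q. norm (F (of_real R * exp (- q))) \<le> c * norm (1 - exp (- q)) powr d) rhp0"
    by eventually_elim (use R in \<open>simp add: norm_powr_real_powr'\<close>)
  thus ?thesis using that c(1) by blast
qed

lemma bigo_transfer_tendsto_0:
  assumes F: "F \<in> bigo (at (of_real R) within D) (\<lambda>z. (1 - z / of_real R) powr of_real d)"
    and R: "R > 0" and D: "\<And>q. q \<in> slit_strip \<Longrightarrow> of_real R * exp (- q) \<in> D" and d: "d > 0"
  shows "((\<lambda>q. F (of_real R * exp (- q))) \<longlongrightarrow> 0) rhp0"
proof -
  obtain c where "eventually (\<lambda>q. norm (F (of_real R * exp (- q))) \<le> c * norm (1 - exp (- q)) powr d) rhp0"
    using bigo_transfer_rhp0[OF F R D] by blast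
  moreover have "((\<lambda>q. c * norm (1 - exp (- q :: complex)) powr d) \<longlongrightarrow> 0) rhp0"
    by (intro tendsto_mult_right_zero tendsto_zero_powrI[OF tendsto_norm_one_minus_exp tendsto_const _ d]) auto
  ultimately show ?thesis by (rule Lim_null_comparison)
qed

text \<open>Of the exponent \<open>2 + d\<close>, the part \<open>2\<close> is matched by
  \<open>q^2\<close>, since \<open>(1 - exp (- q)) / q\<close> tends to \<open>1\<close>, and the
  part \<open>d\<close> tends to zero.\<close>

lemma bigo_transfer_square:
  assumes F: "F \<in> bigo (at (of_real R) within D) (\<lambda>z. (1 - z / of_real R) powr of_real (2 + d))"
    and R: "R > 0" and D: "\<And>q. q \<in> slit_strip \<Longrightarrow> of_real R * exp (- q) \<in> D" and d: "d > 0"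
  shows "((\<lambda>q. F (of_real R * exp (- q)) / q\<^sup>2) \<longlongrightarrow> 0) rhp0"
proof -
  obtain c where c: "c > 0" "eventually (\<lambda>q. norm (F (of_real R * exp (- q))) \<le> c * norm (1 - exp (- q)) powr (2 + d)) rhp0"
    by (rule bigo_transfer_rhp0[OF F R D])
  have "eventually (\<lambda>q. norm (F (of_real R * exp (- q)) / q\<^sup>2) \<le>
      c * (norm (1 - exp (- q)) powr d * (norm ((1 - exp (- q)) / q))\<^sup>2)) rhp0"
    using c(2) eventually_rhp0
  proof eventually_elim
    case (elim q)
    hence "q \<noteq> 0" by auto
    have "norm (1 - exp (- q)) powr (2 + d) = norm (1 - exp (- q)) powr d * (norm (1 - exp (- q)))\<^sup>2"
      \<comment> \<open>Where the base is zero, both sides are zero by the convention for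
        \<open>powr\<close>.\<close>
      by (cases "exp (- q) = 1") (simp_all add: powr_add powr_numeral)
    with elim show ?case using \<open>q \<noteq> 0\<close>
      by (simp add: norm_divide norm_power power_divide divide_right_mono)
  qed
  moreover have "((\<lambda>q. c * (norm (1 - exp (- q :: complex)) powr d * (norm ((1 - exp (- q)) / q))\<^sup>2)) \<longlongrightarrow> c * (0 * (norm (1::complex))\<^sup>2)) rhp0"
    by (intro tendsto_intros one_minus_exp_limits tendsto_zero_powrI[OF tendsto_norm_one_minus_exp tendsto_const _ d]) auto
  hence L: "((\<lambda>q. c * (norm (1 - exp (- q :: complex)) powr d * (norm ((1 - exp (- q)) / q))\<^sup>2)) \<longlongrightarrow> 0) rhp0"
    by simp
  ultimately show ?thesis by (rule Lim_null_comparison)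
qed

section \<open>Assembling the coefficient asymptotics\<close>

lemma exp_sqrt_expansion:
  assumes "u \<ge> 0"
  shows "(\<lambda>N::nat. real N * exp (- u / sqrt (real N)) - real N + sqrt (real N) * u - u\<^sup>2 / 2) \<longlonglongrightarrow> 0"
proof (cases "u = 0")
  case False
  hence "u > 0" using assms by simp
  thus ?thesis unfolding power2_eq_square by real_asymp
qed simp

text \<open>Isolated so that it can be instantiated twice: with the given \<open>f\<close> and
  \<open>u\<close>, and with \<open>f = 1\<close>, \<open>u = 0\<close> for H_N.\<close>

lemma zcoeff_asymp:
  fixes theta kappa :: "nat \<Rightarrow> real"
    and R eta phi theta_star delta c2 u :: real
    and Gt Gk f :: "complex \<Rightarrow> complex"
  assumes kappa_nonneg: "\<And>j. kappa j \<ge> 0"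
    and non_arith: "\<not> (\<exists>j0::nat. j0 > 1 \<and> (\<forall>j\<ge>1. kappa j \<noteq> 0 \<longrightarrow> j0 dvd j))"
    and kappa_pos: "\<exists>j\<ge>2. kappa j > 0"
    and R_pos: "R > 0"
    and rad_kappa: "conv_radius (gcoeffs kappa) = ereal R"
    and eta: "eta > 0" and phi: "0 < phi" "phi < pi / 2"
    and Gt_hol: "Gt holomorphic_on Delta0 R eta phi"
    and Gk_hol: "Gk holomorphic_on Delta0 R eta phi"
    and Gt_ext: "\<And>z. norm z < R \<Longrightarrow> Gt z = gfun theta z"
    and Gk_ext: "\<And>z. norm z < R \<Longrightarrow> Gk z = gfun kappa z"
    and c2_pos: "c2 > 0"
    and theta_star: "theta_star \<ge> 0"
    and delta: "delta > 0"
    and exp_theta: "(\<lambda>z. Gt z + complex_of_real theta_star * Ln (1 - z / complex_of_real R))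
        \<in> bigo (at (complex_of_real R) within Delta0 R eta phi)
            (\<lambda>z. (1 - z / complex_of_real R) powr complex_of_real delta)"
    and exp_kappa: "(\<lambda>z. Gk z - (gfun kappa (complex_of_real R) - (1 - z / complex_of_real R)
              + complex_of_real (c2 / 2) * (1 - z / complex_of_real R) ^ 2))
        \<in> bigo (at (complex_of_real R) within Delta0 R eta phi)
            (\<lambda>z. (1 - z / complex_of_real R) powr complex_of_real (2 + delta))"
    and f_hol: "f holomorphic_on Delta0 R eta phi"
    and f_exp: "(\<lambda>z. f z - 1)
        \<in> bigo (at (complex_of_real R) within Delta0 R eta phi)
            (\<lambda>z. (1 - z / complex_of_real R) powr complex_of_real delta)"
    and u: "u \<ge> 0"
  shows "(\<lambda>N::nat. zcoeff N (\<lambda>z. f z * exp (complex_of_real (exp (- u / sqrt (real N)))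
              * (gfun theta z + of_nat N * gfun kappa z))))
         \<sim>[at_top]
         (\<lambda>N::nat. complex_of_real
              (exp (real N * Re (gfun kappa (complex_of_real R))
                    - sqrt (real N) * u * Re (gfun kappa (complex_of_real R))
                    + u ^ 2 / 2 * Re (gfun kappa (complex_of_real R))) / R ^ N
               * (real N * (1 + c2) / 2) powr ((theta_star - 1) / 2))
            * Jfun (u * sqrt (2 / (1 + c2))) (complex_of_real theta_star) / (2 * pi * \<i>))"
proof -
  define D where "D = Delta0 R eta phi"
  define b where "b = (1 + c2) / 2"
  define K where "K = gfun kappa (of_real R)"
  define M where "M = Re K"
  define Z where "Z = (\<lambda>q. complex_of_real R * exp (- q))"
  have b: "b > 0" using c2_pos by (simp add: b_def)
  have in_D: "z \<in> D" if "norm z \<le> R" "z \<noteq> of_real R" for z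
    unfolding D_def by (rule norm_le_R_in_Delta0) (use that R_pos eta phi in auto)
  have cball_D: "cball 0 R - {of_real R} \<subseteq> D" using in_D by (intro subsetI) simp
  have ball_D: "ball 0 R \<subseteq> D"
  proof
    fix z :: complex assume "z \<in> ball 0 R"
    hence "norm z < R" by simp
    thus "z \<in> D" using in_D[of z] R_pos by (cases "z = of_real R") auto
  qed
  have Z_in_D: "Z q \<in> D" if "q \<in> slit_strip" for q
    unfolding Z_def using exp_slit_strip[OF that R_pos] by (intro in_D)
  have norm_Z: "norm (Z q) < R" if "Re q > 0" for q
    using that R_pos by (simp add: Z_def norm_mult norm_exp_eq_Re)
  have cont_D: "continuous_on slit_strip (\<lambda>q. F (Z q))" if "F holomorphic_on D" for F
    by (rule continuous_on_compose2[OF holomorphic_on_imp_continuous_on[OF that]])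
       (use Z_in_D in \<open>auto simp: Z_def intro!: continuous_intros\<close>)

  have lim_f: "((\<lambda>q. f (Z q) - 1) \<longlongrightarrow> 0) rhp0"
    using bigo_transfer_tendsto_0[OF f_exp R_pos _ delta] Z_in_D by (simp add: Z_def D_def)
  have lim_t: "((\<lambda>q. Gt (Z q) + of_real theta_star * Ln (1 - exp (- q))) \<longlongrightarrow> 0) rhp0"
    using bigo_transfer_tendsto_0[OF exp_theta R_pos _ delta] Z_in_D R_pos by (simp add: Z_def D_def)
  have lim_k: "((\<lambda>q. (Gk (Z q) - (K - (1 - exp (- q)) + of_real (c2 / 2) * (1 - exp (- q))\<^sup>2)) / q\<^sup>2) \<longlongrightarrow> 0) rhp0"
    using bigo_transfer_square[OF exp_kappa R_pos _ delta] Z_in_D R_pos by (simp add: Z_def D_def K_def)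

  have lim_C: "((\<lambda>q. (Gk (Z q) - K + q - of_real b * q\<^sup>2) / q\<^sup>2) \<longlongrightarrow> 0) rhp0"
  proof -
    \<comment> \<open>With \<open>x = 1 - exp (- q)\<close> three errors of order
      \<open>o(q^2)\<close> are added: that of the given expansion, that of
      \<open>q - x - q^2 / 2\<close>, and that of \<open>c2 / 2 * (x^2 - q^2)\<close>. The resulting
      coefficient \<open>1 / 2 + c2 / 2\<close> is \<open>b\<close>.\<close>
    have "((\<lambda>q. (Gk (Z q) - (K - (1 - exp (- q)) + of_real (c2 / 2) * (1 - exp (- q))\<^sup>2)) / q\<^sup>2
             + (q - (1 - exp (- q)) - q\<^sup>2 / 2) / q\<^sup>2 + of_real (c2 / 2) * (((1 - exp (- q)) / q)\<^sup>2 - 1))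
          \<longlongrightarrow> 0 + 0 + of_real (c2 / 2) * (1\<^sup>2 - 1)) rhp0"
      by (intro tendsto_intros lim_k one_minus_exp_limits)
    moreover have "eventually (\<lambda>q. (Gk (Z q) - (K - (1 - exp (- q)) + of_real (c2 / 2) * (1 - exp (- q))\<^sup>2)) / q\<^sup>2
             + (q - (1 - exp (- q)) - q\<^sup>2 / 2) / q\<^sup>2 + of_real (c2 / 2) * (((1 - exp (- q)) / q)\<^sup>2 - 1)
           = (Gk (Z q) - K + q - of_real b * q\<^sup>2) / q\<^sup>2) rhp0"
      using eventually_rhp0
    proof eventually_elim
      case (elim q)
      hence "q \<noteq> 0" by auto
      have "(g - (K - x + of_real (c2 / 2) * x\<^sup>2)) / q\<^sup>2 + (q - x - q\<^sup>2 / 2) / q\<^sup>2 + of_real (c2 / 2) * ((x / q)\<^sup>2 - 1)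
           = (g - K + q - of_real b * q\<^sup>2) / q\<^sup>2" for g x
        using \<open>q \<noteq> 0\<close> by (simp add: b_def field_simps)
      thus ?case .
    qed
    ultimately show ?thesis by (simp add: Lim_transform_eventually)
  qed
  have lim_Gk: "((\<lambda>q. Gk (Z q)) \<longlongrightarrow> K) rhp0"
  proof -
    have "((\<lambda>q. (Gk (Z q) - K + q - of_real b * q\<^sup>2) / q\<^sup>2 * q\<^sup>2 - q + of_real b * q\<^sup>2 + K) \<longlongrightarrow> 0 * 0\<^sup>2 - 0 + of_real b * 0\<^sup>2 + K) rhp0"
      by (intro tendsto_intros lim_C)
    moreover have "eventually (\<lambda>q. (Gk (Z q) - K + q - of_real b * q\<^sup>2) / q\<^sup>2 * q\<^sup>2 - q + of_real b * q\<^sup>2 + K = Gk (Z q)) rhp0"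
      using eventually_rhp0 by eventually_elim auto
    ultimately show ?thesis by (simp add: Lim_transform_eventually)
  qed

  \<comment> \<open>The real radii belonging to \<open>q = 1 / (n + 1)\<close>. Along them the
    series tends to \<open>K\<close>, which identifies \<open>K\<close> as a real number and as the
    strict upper bound for \<open>Re Gk\<close> on the closed disc.\<close>
  define r where "r = (\<lambda>n. R * exp (- (1 / real (Suc n))))"
  have r: "r n < R" "r n > 0" for n using R_pos by (simp_all add: r_def)
  have "r \<longlonglongrightarrow> R" unfolding r_def by real_asymp
  have "filterlim (\<lambda>n. complex_of_real (1 / real (Suc n))) rhp0 sequentially"
    unfolding filterlim_at
  proof
    show "(\<lambda>n. complex_of_real (1 / real (Suc n))) \<longlonglongrightarrow> 0"
    proof -
      have "(\<lambda>n. 1 / real (Suc n)) \<longlonglongrightarrow> 0" by real_asymp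
      from tendsto_of_real[OF this, where 'a = complex] show ?thesis by (simp only: of_real_0)
    qed
    have "Re (complex_of_real (1 / real (Suc n))) > 0" for n by (simp only: Re_complex_of_real) simp
    moreover have "complex_of_real (1 / real (Suc n)) \<noteq> 0" for n by (simp only: of_real_eq_0_iff) simp
    ultimately show "eventually (\<lambda>n. complex_of_real (1 / real (Suc n)) \<in> {q. Re q > 0} \<and>
        complex_of_real (1 / real (Suc n)) \<noteq> 0) sequentially"
      by (intro always_eventually) blast
  qed
  from filterlim_compose[OF lim_Gk this] have lim_r: "(\<lambda>n. Gk (of_real (r n))) \<longlonglongrightarrow> K"
    by (simp add: Z_def r_def exp_of_real[symmetric])
  have Gk_r: "Gk (of_real (r n)) = gfun kappa (of_real (r n))" for n
    using r[of n] by (intro Gk_ext) simp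
  have K: "K = of_real M"
  proof -
    have "(\<lambda>n. Im (Gk (of_real (r n)))) \<longlonglongrightarrow> Im K" by (intro tendsto_intros lim_r)
    moreover have "Im (Gk (of_real (r n))) = 0" for n
      unfolding Gk_r using r[of n] by (intro gfun_of_real_in_Reals[OF rad_kappa]) auto
    ultimately have "Im K = 0" by (simp add: LIMSEQ_const_iff)
    thus ?thesis by (simp add: M_def complex_eq_iff)
  qed
  have Re_neg: "Re (Gk (Z q) - K) < 0" if q: "q \<in> slit_strip" for q
  proof -
    have "Re (Gk (Z q)) < M"
    proof (rule Re_less_on_closed_disc[OF kappa_nonneg rad_kappa R_pos non_arith kappa_pos,
          where G = Gk and r = r and z = "Z q"])
      show "continuous_on (cball 0 R - {of_real R}) Gk"
        by (rule continuous_on_subset[OF holomorphic_on_imp_continuous_on[OF Gk_hol]])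
           (use cball_D in \<open>simp add: D_def\<close>)
      show "(\<lambda>n. Re (gfun kappa (of_real (r n)))) \<longlonglongrightarrow> M"
        using tendsto_Re[OF lim_r] by (simp add: Gk_r M_def)
      show "norm (Z q) \<le> R" "Z q \<noteq> of_real R"
        unfolding Z_def by (rule exp_slit_strip[OF q R_pos])+
    qed (fact r \<open>r \<longlonglongrightarrow> R\<close> Gk_ext)+
    thus ?thesis by (simp add: M_def)
  qed

  interpret S: saddle "\<lambda>q. f (Z q)" "\<lambda>q. Gt (Z q)" "\<lambda>q. Gk (Z q) - K" b theta_star u
  proof
    show "continuous_on slit_strip (\<lambda>q. f (Z q))" "continuous_on slit_strip (\<lambda>q. Gt (Z q))"
      "continuous_on slit_strip (\<lambda>q. Gk (Z q) - K)"
      using cont_D f_hol Gt_hol Gk_hol by (auto simp: D_def intro!: continuous_intros)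
    show "((\<lambda>q. f (Z q)) \<longlongrightarrow> 1) rhp0" using lim_f by (simp add: LIM_zero_iff)
    \<comment> \<open>The logarithm of \<open>1 - z / R\<close> is traded for \<open>Ln q\<close>;
      their difference tends to zero.\<close>
    have "((\<lambda>q. (Gt (Z q) + of_real theta_star * Ln (1 - exp (- q))) - of_real theta_star * (Ln (1 - exp (- q)) - Ln q))
        \<longlongrightarrow> 0 - of_real theta_star * 0) rhp0"
      by (intro tendsto_intros lim_t one_minus_exp_limits)
    thus "((\<lambda>q. Gt (Z q) + of_real theta_star * Ln q) \<longlongrightarrow> 0) rhp0" by (simp add: algebra_simps)
  qed (use lim_C Re_neg b theta_star u in auto)

  define F where "F = (\<lambda>N z. f z * exp (complex_of_real (exp (- u / sqrt (real N))) * (gfun theta z + of_nat N * gfun kappa z)))"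
  define I where "I = (\<lambda>N. LBINT y. indicator {- pi * sqrt (real N)..pi * sqrt (real N)} y *\<^sub>R (of_real (real N powr (- theta_star / 2)) * S.W N y))"
  define L where "L = of_real (b powr ((theta_star - 1) / 2)) * Jline (u / sqrt b) theta_star"
  define T where "T = (\<lambda>N. complex_of_real
              (exp (real N * M - sqrt (real N) * u * M + u ^ 2 / 2 * M) / R ^ N
               * (real N * (1 + c2) / 2) powr ((theta_star - 1) / 2))
            * Jfun (u * sqrt (2 / (1 + c2))) (complex_of_real theta_star) / (2 * pi * \<i>))"
  \<comment> \<open>The exact discrepancy between the constant exponent \<open>e * N * M\<close> of
    the coefficient and the exponent in the claim; it tends to zero by the second-order expansion of
    the tilt.\<close>
  define E where "E = (\<lambda>N. M * (real N * exp (- u / sqrt (real N)) - real N + sqrt (real N) * u - u\<^sup>2 / 2))"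
  have I: "I \<longlonglongrightarrow> L" unfolding I_def L_def by (rule S.W_integral_tendsto)
  have L: "L \<noteq> 0" using b Jline_nonzero[OF theta_star] by (simp add: L_def)

  have F_hol: "F N holomorphic_on ball 0 R" for N
  proof -
    have "(\<lambda>z. f z * exp (complex_of_real (exp (- u / sqrt (real N))) * (Gt z + of_nat N * Gk z))) holomorphic_on ball 0 R"
      using ball_D unfolding D_def
      by (intro holomorphic_intros holomorphic_on_subset[OF f_hol] holomorphic_on_subset[OF Gt_hol]
          holomorphic_on_subset[OF Gk_hol])
    thus ?thesis by (rule holomorphic_transform) (auto simp: F_def Gt_ext Gk_ext)
  qed

  \<comment> \<open>An identity for every \<open>N > 0\<close>, with no error term: all analysis is
    confined to the convergence of \<open>I\<close>.\<close>
  have coeff: "zcoeff N (F N) = of_real (exp (S.e N * real N * M) * real N powr (theta_star / 2) / (2 * pi * sqrt (real N) * R ^ N)) * I N"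
    if N: "N > 0" for N
  proof -
    define s where "s = sqrt (real N)"
    have s: "s > 0" "s * s = real N" using N by (simp_all add: s_def)
    have "zcoeff N (F N) = 1 / (2 * pi * s * R ^ N) *
     (LBINT y. indicator {-pi * s..pi * s} y *\<^sub>R
        (F N (of_real R * exp (- ((of_real (1 / sqrt b) - \<i> * of_real y) / of_real s))) *
           exp (of_nat N * ((of_real (1 / sqrt b) - \<i> * of_real y) / of_real s))))"
      by (rule zcoeff_conv_integral_exp[OF F_hol R_pos _ s(1)]) (use b in auto)
    also have "(\<lambda>y. indicator {-pi * s..pi * s} y *\<^sub>R
        (F N (of_real R * exp (- ((of_real (1 / sqrt b) - \<i> * of_real y) / of_real s))) *
           exp (of_nat N * ((of_real (1 / sqrt b) - \<i> * of_real y) / of_real s))))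
       = (\<lambda>y. of_real (exp (S.e N * real N * M) * real N powr (theta_star / 2)) *
            (indicator {- pi * s..pi * s} y *\<^sub>R (of_real (real N powr (- theta_star / 2)) * S.W N y)))"
    proof
      fix y
      define q where "q = S.q N y"
      have q: "(of_real (1 / sqrt b) - \<i> * of_real y) / of_real s = q"
        by (simp add: q_def S.q_def S.v_def s_def)
      have Z: "of_real R * exp (- q) = Z q" by (simp add: Z_def)
      have nZ: "norm (Z q) < R" unfolding q_def by (intro norm_Z S.Re_q_pos N)
      have Nq: "of_nat N * q = S.v y * of_real s"
        using s N by (simp add: q_def S.q_def s_def field_simps flip: of_real_mult)
      have "F N (Z q) * exp (of_nat N * q) =
          f (Z q) * exp (of_real (S.e N) * (Gt (Z q) + of_nat N * Gk (Z q)) + S.v y * of_real s)"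
        unfolding Nq by (simp add: F_def S.e_def Gt_ext[OF nZ] Gk_ext[OF nZ] exp_add)
      also have "of_real (S.e N) * (Gt (Z q) + of_nat N * Gk (Z q)) + S.v y * of_real s =
         of_real (S.e N * real N * M) + (of_real (S.e N) * Gt (Z q) + of_real (S.e N * real N) * (Gk (Z q) - K) + S.v y * of_real s)"
        unfolding K by (simp add: algebra_simps)
      also have "f (Z q) * exp \<dots> = of_real (exp (S.e N * real N * M)) * S.W N y"
        unfolding exp_add[of "of_real (S.e N * real N * M)"] S.W_def q_def[symmetric] s_def[symmetric] exp_of_real by simp
      also have "\<dots> = of_real (exp (S.e N * real N * M) * real N powr (theta_star / 2)) * (of_real (real N powr (- theta_star / 2)) * S.W N y)"
      proof -
        have "real N powr (theta_star / 2) * real N powr (- theta_star / 2) = 1"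
          using N by (simp flip: powr_add)
        hence "complex_of_real (real N powr (theta_star / 2)) * of_real (real N powr (- theta_star / 2)) = 1"
          by (metis of_real_1 of_real_mult)
        thus ?thesis by (simp add: mult.assoc)
      qed
      finally have "F N (Z q) * exp (of_nat N * q) = of_real (exp (S.e N * real N * M) * real N powr (theta_star / 2)) * (of_real (real N powr (- theta_star / 2)) * S.W N y)" .
      thus "indicator {-pi * s..pi * s} y *\<^sub>R
        (F N (of_real R * exp (- ((of_real (1 / sqrt b) - \<i> * of_real y) / of_real s))) *
           exp (of_nat N * ((of_real (1 / sqrt b) - \<i> * of_real y) / of_real s)))
       = of_real (exp (S.e N * real N * M) * real N powr (theta_star / 2)) *
            (indicator {- pi * s..pi * s} y *\<^sub>R (of_real (real N powr (- theta_star / 2)) * S.W N y))"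
        unfolding q Z by (simp only: mult_scaleR_right)
    qed
    also have "(LBINT y. of_real (exp (S.e N * real N * M) * real N powr (theta_star / 2)) *
            (indicator {- pi * s..pi * s} y *\<^sub>R (of_real (real N powr (- theta_star / 2)) * S.W N y)))
       = of_real (exp (S.e N * real N * M) * real N powr (theta_star / 2)) * I N"
      unfolding I_def s_def by (rule integral_mult_right_zero)
    finally show ?thesis unfolding s_def by simp
  qed
  have T: "T N = of_real (exp (real N * M - sqrt (real N) * u * M + u\<^sup>2 / 2 * M) * real N powr (theta_star / 2) / (2 * pi * sqrt (real N) * R ^ N)) * L"
    if N: "N > 0" for N
  proof -
    have ub: "u * sqrt (2 / (1 + c2)) = u / sqrt b"
      by (simp add: b_def real_sqrt_divide)
    have "(real N * (1 + c2) / 2) powr ((theta_star - 1) / 2) = real N powr ((theta_star - 1) / 2) * b powr ((theta_star - 1) / 2)"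
      using b powr_mult[of "real N" b "(theta_star - 1) / 2"] by (simp add: b_def)
    also have "real N powr ((theta_star - 1) / 2) = real N powr (theta_star / 2) / sqrt (real N)"
      using N by (simp add: diff_divide_distrib powr_diff powr_half_sqrt)
    finally have p: "(real N * (1 + c2) / 2) powr ((theta_star - 1) / 2) = real N powr (theta_star / 2) / sqrt (real N) * b powr ((theta_star - 1) / 2)" .
    show ?thesis
      unfolding T_def ub p Jfun_eq_Jline[OF theta_star] L_def by (simp add: mult_ac)
  qed
  have "(\<lambda>N. of_real (exp (E N)) * I N / L) \<longlonglongrightarrow> of_real (exp (M * 0)) * L / L"
    unfolding E_def by (intro tendsto_intros I L exp_sqrt_expansion u)
  hence "(\<lambda>N. of_real (exp (E N)) * I N / L) \<longlonglongrightarrow> 1" using L by simp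
  moreover have "eventually (\<lambda>N. of_real (exp (E N)) * I N / L = zcoeff N (F N) / T N) sequentially"
    using eventually_gt_at_top[of 0]
  proof eventually_elim
    case (elim N)
    define a where "a = real N powr (theta_star / 2) / (2 * pi * sqrt (real N) * R ^ N)"
    define d where "d = real N * M - sqrt (real N) * u * M + u\<^sup>2 / 2 * M"
    have a: "a > 0" using elim R_pos by (simp add: a_def)
    have e: "S.e N * real N * M = d + E N" by (simp add: d_def E_def S.e_def algebra_simps)
    have "zcoeff N (F N) = of_real (exp d) * of_real (exp (E N)) * of_real a * I N"
      unfolding coeff[OF elim] e by (simp add: a_def exp_add)
    moreover have "T N = of_real (exp d) * of_real a * L"
      unfolding T[OF elim] by (simp add: a_def d_def)
    moreover have "complex_of_real (exp d) \<noteq> 0" by simp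
    ultimately show ?case using a L by simp
  qed
  ultimately have "(\<lambda>N. zcoeff N (F N) / T N) \<longlonglongrightarrow> 1" by (rule Lim_transform_eventually)
  hence "(\<lambda>N. zcoeff N (F N)) \<sim>[at_top] T" by (rule asymp_equivI')
  thus ?thesis unfolding F_def T_def M_def K_def .
qed

text \<open>The embedding commutes with the quotient that defines the relation, including its
  default value \<open>1\<close> where both functions vanish.\<close>

lemma asymp_equiv_of_real_iff:
  "(\<lambda>x. complex_of_real (f x)) \<sim>[F] (\<lambda>x. complex_of_real (g x)) \<longleftrightarrow> f \<sim>[F] g"
proof -
  have "(\<lambda>x. if complex_of_real (f x) = 0 \<and> complex_of_real (g x) = 0 then 1 else complex_of_real (f x) / complex_of_real (g x))
      = (\<lambda>x. complex_of_real (if f x = 0 \<and> g x = 0 then 1 else f x / g x))" by auto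
  hence "(\<lambda>x. complex_of_real (f x)) \<sim>[F] (\<lambda>x. complex_of_real (g x)) \<longleftrightarrow>
      ((\<lambda>x. complex_of_real (if f x = 0 \<and> g x = 0 then 1 else f x / g x)) \<longlongrightarrow> of_real 1) F"
    by (simp only: asymp_equiv_def of_real_1)
  also have "\<dots> \<longleftrightarrow> f \<sim>[F] g"
    by (simp only: asymp_equiv_def tendsto_of_real_iff)
  finally show ?thesis .
qed

theorem theorem3p12:
  fixes theta kappa :: "nat \<Rightarrow> real"
    and R eta phi theta_star delta c2 u :: real
    and Gt Gk f :: "complex \<Rightarrow> complex"
  assumes theta_nonneg: "\<And>j. theta j \<ge> 0"
    and kappa_nonneg: "\<And>j. kappa j \<ge> 0"
    and non_arith: "\<not> (\<exists>j0::nat. j0 > 1 \<and> (\<forall>j\<ge>1. kappa j \<noteq> 0 \<longrightarrow> j0 dvd j))"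
    and kappa_pos: "\<exists>j\<ge>2. kappa j > 0"
    and R_pos: "R > 0"
    and rad_theta: "conv_radius (gcoeffs theta) = ereal R"
    and rad_kappa: "conv_radius (gcoeffs kappa) = ereal R"
    and eta: "eta > 0" and phi: "0 < phi" "phi < pi / 2"
    and Gt_hol: "Gt holomorphic_on Delta0 R eta phi"
    and Gk_hol: "Gk holomorphic_on Delta0 R eta phi"
    and Gt_ext: "\<And>z. norm z < R \<Longrightarrow> Gt z = gfun theta z"
    and Gk_ext: "\<And>z. norm z < R \<Longrightarrow> Gk z = gfun kappa z"
    and gk1: "((\<lambda>r. r * deriv (greal kappa) r) \<longlongrightarrow> 1) (at_left R)"
    and gk2: "((\<lambda>r. r ^ 2 * (deriv ^^ 2) (greal kappa) r) \<longlongrightarrow> c2) (at_left R)"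
    and c2_pos: "c2 > 0"
    and theta_star: "theta_star \<ge> 0"
    and delta: "delta > 0"
    and exp_theta: "(\<lambda>z. Gt z + complex_of_real theta_star * Ln (1 - z / complex_of_real R))
        \<in> bigo (at (complex_of_real R) within Delta0 R eta phi)
            (\<lambda>z. (1 - z / complex_of_real R) powr complex_of_real delta)"
    and exp_kappa: "(\<lambda>z. Gk z - (gfun kappa (complex_of_real R) - (1 - z / complex_of_real R)
              + complex_of_real (c2 / 2) * (1 - z / complex_of_real R) ^ 2))
        \<in> bigo (at (complex_of_real R) within Delta0 R eta phi)
            (\<lambda>z. (1 - z / complex_of_real R) powr complex_of_real (2 + delta))"
    and f_hol: "f holomorphic_on Delta0 R eta phi"
    and f_exp: "(\<lambda>z. f z - 1)
        \<in> bigo (at (complex_of_real R) within Delta0 R eta phi)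
            (\<lambda>z. (1 - z / complex_of_real R) powr complex_of_real delta)"
    and u: "u \<ge> 0"
  shows "(\<lambda>N::nat. zcoeff N (\<lambda>z. f z * exp (complex_of_real (exp (- u / sqrt (real N)))
              * (gfun theta z + of_nat N * gfun kappa z))))
         \<sim>[at_top]
         (\<lambda>N::nat. complex_of_real
              (exp (real N * Re (gfun kappa (complex_of_real R))
                    - sqrt (real N) * u * Re (gfun kappa (complex_of_real R))
                    + u ^ 2 / 2 * Re (gfun kappa (complex_of_real R))) / R ^ N
               * (real N * (1 + c2) / 2) powr ((theta_star - 1) / 2))
            * Jfun (u * sqrt (2 / (1 + c2))) (complex_of_real theta_star) / (2 * pi * \<i>))
    \<and> (\<lambda>N::nat. HN theta kappa N)
         \<sim>[at_top]
         (\<lambda>N::nat. exp (real N * Re (gfun kappa (complex_of_real R)))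
              * (real N * (1 + c2) / 2) powr ((theta_star - 1) / 2)
              / (2 * R ^ N * Gamma ((1 + theta_star) / 2)))"
proof
  note asymp = zcoeff_asymp[OF kappa_nonneg non_arith kappa_pos R_pos rad_kappa eta phi Gt_hol Gk_hol
      Gt_ext Gk_ext c2_pos theta_star delta exp_theta exp_kappa]
  show "(\<lambda>N::nat. zcoeff N (\<lambda>z. f z * exp (complex_of_real (exp (- u / sqrt (real N)))
              * (gfun theta z + of_nat N * gfun kappa z))))
         \<sim>[at_top]
         (\<lambda>N::nat. complex_of_real
              (exp (real N * Re (gfun kappa (complex_of_real R))
                    - sqrt (real N) * u * Re (gfun kappa (complex_of_real R))
                    + u ^ 2 / 2 * Re (gfun kappa (complex_of_real R))) / R ^ N
               * (real N * (1 + c2) / 2) powr ((theta_star - 1) / 2))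
            * Jfun (u * sqrt (2 / (1 + c2))) (complex_of_real theta_star) / (2 * pi * \<i>))"
    by (rule asymp[OF _ _ f_hol f_exp u])
  define T where "T = (\<lambda>N::nat. exp (real N * Re (gfun kappa (complex_of_real R)))
              * (real N * (1 + c2) / 2) powr ((theta_star - 1) / 2)
              / (2 * R ^ N * Gamma ((1 + theta_star) / 2)))"
  \<comment> \<open>The factor \<open>\<i>\<close> from the vertical line and the \<open>pi\<close>
    of the Gaussian moment cancel against \<open>2 * pi * \<i>\<close>, which leaves the
    \<open>2\<close> in the denominator.\<close>
  have J0: "Jfun 0 (of_real theta_star) / (2 * pi * \<i>) = of_real (1 / (2 * Gamma ((1 + theta_star) / 2)))"
    unfolding Jfun_eq_Jline[OF theta_star] Jline_xi_0[OF theta_star] by simp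
  have HN: "complex_of_real (HN theta kappa N) =
      zcoeff N (\<lambda>z. 1 * exp (complex_of_real (exp (- 0 / sqrt (real N))) * (gfun theta z + of_nat N * gfun kappa z)))" for N
    using HN_eq_zcoeff[of theta kappa N] R_pos rad_theta rad_kappa by simp
  have T: "complex_of_real (T N) = complex_of_real
              (exp (real N * Re (gfun kappa (complex_of_real R))
                    - sqrt (real N) * 0 * Re (gfun kappa (complex_of_real R))
                    + 0 ^ 2 / 2 * Re (gfun kappa (complex_of_real R))) / R ^ N
               * (real N * (1 + c2) / 2) powr ((theta_star - 1) / 2))
            * Jfun (0 * sqrt (2 / (1 + c2))) (complex_of_real theta_star) / (2 * pi * \<i>)" for N
    unfolding mult_zero_left times_divide_eq_right[symmetric] J0 of_real_mult[symmetric] by (simp add: T_def)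
  \<comment> \<open>At \<open>f = 1\<close>, \<open>u = 0\<close> the tilt is \<open>1\<close> and
    \<open>f - 1\<close> vanishes identically, so its growth condition is immediate.\<close>
  have "(\<lambda>N. complex_of_real (HN theta kappa N)) \<sim>[at_top] (\<lambda>N. complex_of_real (T N))"
    unfolding HN T by (rule asymp) auto
  hence "(\<lambda>N. HN theta kappa N) \<sim>[at_top] T" by (simp add: asymp_equiv_of_real_iff)
  thus "(\<lambda>N. HN theta kappa N) \<sim>[at_top]
         (\<lambda>N::nat. exp (real N * Re (gfun kappa (complex_of_real R)))
              * (real N * (1 + c2) / 2) powr ((theta_star - 1) / 2)
              / (2 * R ^ N * Gamma ((1 + theta_star) / 2)))" unfolding T_def .
qed

end
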